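(* Let $D$ be a left raiser in a monoidal category $\mathcal{C}$, with associated functor $S:\mathcal{C}^{\mathrm{op}}\to\mathcal{C}$ and morphisms $e_{A,B}:S(A\otimes B)\otimes A\to SB$ and $n_I:I\to SSI$. Let $(G,\delta,\epsilon)$ be a monoidal comonad on $\mathcal{C}$ with monoidal structure $\phi_{A,B}:GA\otimes GB\to G(A\otimes B)$, $\phi_0:I\to GI$. If $\nu_A:SA\to GSGA$ is a natural transformation such that, for all objects $A,B$ of $\mathcal{C}$, (Axiom 1) $\epsilon_{SGA}\circ\nu_A=S(\epsilon_A):SA\to SGA$; (Axiom 2) $\delta_{SGA}\circ\nu_A=GGS(\delta_A)\circ G(\nu_{GA})\circ\nu_A:SA\to GGSGA$; (Axiom 3) $\nu_B\circ e_{A,B}\circ(1\otimes\epsilon_A)=G(e_{GA,GB})\circ G(S(\phi_{A,B})\otimes 1)\circ\phi_{SG(A\otimes B),GA}\circ(\nu_{A\otimes B}\otimes\delta_A):S(A\otimes B)\otimes GA\to GSGB$; (Axiom 4) $G(n_I)\circ\phi_0=GS(\nu_I)\circ GSGS(\phi_0)\circ\nu_{SI}\circ n_I:I\to GSSI$; then $(D,\,GS(\phi_0)\circ\nu_I)$ is a left raiser in the monoidal category $\mathcal{C}^G$ of Eilenberg-Moore $G$-coalgebras.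
   Context: Monoidal categories are written as if strict (associativity and unit constraints suppressed). An object $D$ of a monoidal category $\mathcal{C}$ is a left raiser when for every object $B$ there is a chosen object ${}^B D$ with isomorphisms $\varpi_{A,B}:\mathcal{C}(A,{}^B D)\to\mathcal{C}(A\otimes B,D)$ natural in $A$. Then $S:\mathcal{C}^{\mathrm{op}}\to\mathcal{C}$ is the unique functor with $SB={}^B D$ for which $\varpi_{A,B}$ is natural in $B$ too; the choice for $B=I$ is such that $SI=D$ and $\varpi_{A,I}=1$. Put $\omega_{A,B,C}=\varpi_{A\otimes B,C}^{-1}\circ\varpi_{A,B\otimes C}:\mathcal{C}(A,S(B\otimes C))\to\mathcal{C}(A\otimes B,SC)$; $e_{B,C}=\omega_{S(B\otimes C),B,C}(1):S(B\otimes C)\otimes B\to SC$; $\rho_{A,B}=\omega_{I,A,B}^{-1}:\mathcal{C}(A,SB)\to\mathcal{C}(I,S(A\otimes B))$; $n_B=\rho_{SB,B}(1):I\to S(SB\otimes B)$, so that $n_I:I\to S(SI\otimes I)=SSI$. A monoidal comonad is a comonad $(G,\delta:G\to GG,\epsilon:G\to 1)$ whose endofunctor is (lax) monoidal via $\phi,\phi_0$ and whose $\delta,\epsilon$ are monoidal natural transformations. $\mathcal{C}^G$ is the category of coalgebras $(A,\gamma:A\to GA)$, which is monoidal with $(A,\gamma)\otimes(B,\gamma')=(A\otimes B,\phi_{A,B}\circ(\gamma\otimes\gamma'))$ and unit $(I,\phi_0)$. *)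

theory Defs
  imports Main
begin

section \<open>Categories, functors, natural transformations\<close>

record ('o, 'm) cat =
  Obj :: "'o set"
  Arr :: "'m set"
  Dom :: "'m \<Rightarrow> 'o"
  Cod :: "'m \<Rightarrow> 'o"
  Ide :: "'o \<Rightarrow> 'm"
  Comp :: "'m \<Rightarrow> 'm \<Rightarrow> 'm"  (infixr "\<cdot>\<index>" 65)

definition hom :: "('o, 'm, 'x) cat_scheme \<Rightarrow> 'o \<Rightarrow> 'o \<Rightarrow> 'm set" where
  "hom C A B = {f \<in> Arr C. Dom C f = A \<and> Cod C f = B}"

locale category =
  fixes C :: "('o, 'm, 'x) cat_scheme" (structure)
  assumes Dom_Obj: "f \<in> Arr C \<Longrightarrow> Dom C f \<in> Obj C"
    and Cod_Obj: "f \<in> Arr C \<Longrightarrow> Cod C f \<in> Obj C"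
    and Id_hom: "A \<in> Obj C \<Longrightarrow> Ide C A \<in> hom C A A"
    and Comp_hom: "f \<in> hom C A B \<Longrightarrow> g \<in> hom C B E \<Longrightarrow> g \<cdot> f \<in> hom C A E"
    and Comp_Id: "f \<in> hom C A B \<Longrightarrow> f \<cdot> Ide C A = f"
    and Id_Comp: "f \<in> hom C A B \<Longrightarrow> Ide C B \<cdot> f = f"
    and Comp_assoc: "f \<in> hom C A B \<Longrightarrow> g \<in> hom C B E \<Longrightarrow> h \<in> hom C E F
      \<Longrightarrow> (h \<cdot> g) \<cdot> f = h \<cdot> (g \<cdot> f)"

definition inverse_arrows :: "('o, 'm, 'x) cat_scheme \<Rightarrow> 'm \<Rightarrow> 'm \<Rightarrow> bool" where
  "inverse_arrows C f g \<longleftrightarrow>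
     f \<in> Arr C \<and> g \<in> hom C (Cod C f) (Dom C f) \<and>
     g \<cdot>\<^bsub>C\<^esub> f = Ide C (Dom C f) \<and> f \<cdot>\<^bsub>C\<^esub> g = Ide C (Cod C f)"

definition iso :: "('o, 'm, 'x) cat_scheme \<Rightarrow> 'm \<Rightarrow> bool" where
  "iso C f \<longleftrightarrow> (\<exists>g. inverse_arrows C f g)"

definition inverse_arr :: "('o, 'm, 'x) cat_scheme \<Rightarrow> 'm \<Rightarrow> 'm" where
  "inverse_arr C f = (THE g. inverse_arrows C f g)"

definition op_cat :: "('o, 'm, 'x) cat_scheme \<Rightarrow> ('o, 'm) cat" where
  "op_cat C = \<lparr>Obj = Obj C, Arr = Arr C, Dom = Cod C, Cod = Dom C, Ide = Ide C,
     Comp = (\<lambda>g f. f \<cdot>\<^bsub>C\<^esub> g)\<rparr>"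

locale cat_functor = source: category C + target: category C'
  for C :: "('o, 'm, 'x) cat_scheme"
    and C' :: "('o2, 'm2, 'y) cat_scheme" +
  fixes Fo :: "'o \<Rightarrow> 'o2" and Fa :: "'m \<Rightarrow> 'm2"
  assumes Fo_Obj: "A \<in> Obj C \<Longrightarrow> Fo A \<in> Obj C'"
    and Fa_hom: "f \<in> hom C A B \<Longrightarrow> Fa f \<in> hom C' (Fo A) (Fo B)"
    and Fa_Id: "A \<in> Obj C \<Longrightarrow> Fa (Ide C A) = Ide C' (Fo A)"
    and Fa_Comp: "f \<in> hom C A B \<Longrightarrow> g \<in> hom C B E
      \<Longrightarrow> Fa (g \<cdot>\<^bsub>C\<^esub> f) = Fa g \<cdot>\<^bsub>C'\<^esub> Fa f"

locale natural_transformation =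
  F: cat_functor C C' Fo Fa + H: cat_functor C C' Ho Ha
  for C :: "('o, 'm, 'x) cat_scheme"
    and C' :: "('o2, 'm2, 'y) cat_scheme"
    and Fo :: "'o \<Rightarrow> 'o2" and Fa :: "'m \<Rightarrow> 'm2"
    and Ho :: "'o \<Rightarrow> 'o2" and Ha :: "'m \<Rightarrow> 'm2" +
  fixes \<tau> :: "'o \<Rightarrow> 'm2"
  assumes component_hom: "A \<in> Obj C \<Longrightarrow> \<tau> A \<in> hom C' (Fo A) (Ho A)"
    and naturality: "f \<in> hom C A B \<Longrightarrow> \<tau> B \<cdot>\<^bsub>C'\<^esub> Fa f = Ha f \<cdot>\<^bsub>C'\<^esub> \<tau> A"


section \<open>Monoidal categories, functors and natural transformations\<close>

text \<open>
  Monoidal categories are not assumed strict; \<open>assoc\<close>, \<open>lunit\<close> and \<open>runit\<close> are the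
  constraints \<open>(A \<otimes> B) \<otimes> E \<rightarrow> A \<otimes> (B \<otimes> E)\<close>, \<open>I \<otimes> A \<rightarrow> A\<close> and \<open>A \<otimes> I \<rightarrow> A\<close>.
\<close>

record ('o, 'm) moncat = "('o, 'm) cat" +
  tensor_obj :: "'o \<Rightarrow> 'o \<Rightarrow> 'o"  (infixr "\<otimes>\<index>" 75)
  tensor_arr :: "'m \<Rightarrow> 'm \<Rightarrow> 'm"  (infixr "\<boxtimes>\<index>" 75)
  unit_obj :: "'o"  ("\<one>\<index>")
  assoc :: "'o \<Rightarrow> 'o \<Rightarrow> 'o \<Rightarrow> 'm"
  lunit :: "'o \<Rightarrow> 'm"
  runit :: "'o \<Rightarrow> 'm"

locale monoidal_category = category C
  for C :: "('o, 'm, 'x) moncat_scheme" (structure) +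
  assumes tensor_Obj: "A \<in> Obj C \<Longrightarrow> B \<in> Obj C \<Longrightarrow> A \<otimes> B \<in> Obj C"
    and unit_Obj: "\<one> \<in> Obj C"
    and tensor_hom: "f \<in> hom C A A' \<Longrightarrow> g \<in> hom C B B'
      \<Longrightarrow> f \<boxtimes> g \<in> hom C (A \<otimes> B) (A' \<otimes> B')"
    and tensor_Id: "A \<in> Obj C \<Longrightarrow> B \<in> Obj C \<Longrightarrow> Ide C A \<boxtimes> Ide C B = Ide C (A \<otimes> B)"
    and interchange:
      "f \<in> hom C A A' \<Longrightarrow> f' \<in> hom C A' A'' \<Longrightarrow> g \<in> hom C B B' \<Longrightarrow> g' \<in> hom C B' B''
      \<Longrightarrow> (f' \<cdot> f) \<boxtimes> (g' \<cdot> g) = (f' \<boxtimes> g') \<cdot> (f \<boxtimes> g)"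
    and assoc_hom: "A \<in> Obj C \<Longrightarrow> B \<in> Obj C \<Longrightarrow> E \<in> Obj C
      \<Longrightarrow> assoc C A B E \<in> hom C ((A \<otimes> B) \<otimes> E) (A \<otimes> (B \<otimes> E))"
    and assoc_iso: "A \<in> Obj C \<Longrightarrow> B \<in> Obj C \<Longrightarrow> E \<in> Obj C \<Longrightarrow> iso C (assoc C A B E)"
    and assoc_natural: "f \<in> hom C A A' \<Longrightarrow> g \<in> hom C B B' \<Longrightarrow> h \<in> hom C E E'
      \<Longrightarrow> assoc C A' B' E' \<cdot> ((f \<boxtimes> g) \<boxtimes> h) = (f \<boxtimes> (g \<boxtimes> h)) \<cdot> assoc C A B E"
    and lunit_hom: "A \<in> Obj C \<Longrightarrow> lunit C A \<in> hom C (\<one> \<otimes> A) A"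
    and lunit_iso: "A \<in> Obj C \<Longrightarrow> iso C (lunit C A)"
    and lunit_natural: "f \<in> hom C A B
      \<Longrightarrow> lunit C B \<cdot> (Ide C \<one> \<boxtimes> f) = f \<cdot> lunit C A"
    and runit_hom: "A \<in> Obj C \<Longrightarrow> runit C A \<in> hom C (A \<otimes> \<one>) A"
    and runit_iso: "A \<in> Obj C \<Longrightarrow> iso C (runit C A)"
    and runit_natural: "f \<in> hom C A B
      \<Longrightarrow> runit C B \<cdot> (f \<boxtimes> Ide C \<one>) = f \<cdot> runit C A"
    and pentagon: "A \<in> Obj C \<Longrightarrow> B \<in> Obj C \<Longrightarrow> E \<in> Obj C \<Longrightarrow> F \<in> Obj C
      \<Longrightarrow> (Ide C A \<boxtimes> assoc C B E F) \<cdot> assoc C A (B \<otimes> E) F \<cdot> (assoc C A B E \<boxtimes> Ide C F)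
        = assoc C A B (E \<otimes> F) \<cdot> assoc C (A \<otimes> B) E F"
    and triangle: "A \<in> Obj C \<Longrightarrow> B \<in> Obj C
      \<Longrightarrow> (Ide C A \<boxtimes> lunit C B) \<cdot> assoc C A \<one> B = runit C A \<boxtimes> Ide C B"

text \<open>Lax monoidal functors.\<close>

locale monoidal_functor =
  source: monoidal_category C + target: monoidal_category C' + cat_functor C C' Fo Fa
  for C :: "('o, 'm, 'x) moncat_scheme"
    and C' :: "('o2, 'm2, 'y) moncat_scheme"
    and Fo :: "'o \<Rightarrow> 'o2" and Fa :: "'m \<Rightarrow> 'm2" +
  fixes \<phi> :: "'o \<Rightarrow> 'o \<Rightarrow> 'm2" and \<phi>0 :: "'m2"
  assumes phi_hom: "A \<in> Obj C \<Longrightarrow> B \<in> Obj C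
      \<Longrightarrow> \<phi> A B \<in> hom C' (Fo A \<otimes>\<^bsub>C'\<^esub> Fo B) (Fo (A \<otimes>\<^bsub>C\<^esub> B))"
    and phi_natural: "f \<in> hom C A A' \<Longrightarrow> g \<in> hom C B B'
      \<Longrightarrow> \<phi> A' B' \<cdot>\<^bsub>C'\<^esub> (Fa f \<boxtimes>\<^bsub>C'\<^esub> Fa g) = Fa (f \<boxtimes>\<^bsub>C\<^esub> g) \<cdot>\<^bsub>C'\<^esub> \<phi> A B"
    and phi0_hom: "\<phi>0 \<in> hom C' \<one>\<^bsub>C'\<^esub> (Fo \<one>\<^bsub>C\<^esub>)"
    and phi_assoc: "A \<in> Obj C \<Longrightarrow> B \<in> Obj C \<Longrightarrow> E \<in> Obj C
      \<Longrightarrow> Fa (assoc C A B E) \<cdot>\<^bsub>C'\<^esub> \<phi> (A \<otimes>\<^bsub>C\<^esub> B) E \<cdot>\<^bsub>C'\<^esub> (\<phi> A B \<boxtimes>\<^bsub>C'\<^esub> Ide C' (Fo E))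
        = \<phi> A (B \<otimes>\<^bsub>C\<^esub> E) \<cdot>\<^bsub>C'\<^esub> (Ide C' (Fo A) \<boxtimes>\<^bsub>C'\<^esub> \<phi> B E) \<cdot>\<^bsub>C'\<^esub> assoc C' (Fo A) (Fo B) (Fo E)"
    and phi_lunit: "A \<in> Obj C
      \<Longrightarrow> Fa (lunit C A) \<cdot>\<^bsub>C'\<^esub> \<phi> \<one>\<^bsub>C\<^esub> A \<cdot>\<^bsub>C'\<^esub> (\<phi>0 \<boxtimes>\<^bsub>C'\<^esub> Ide C' (Fo A)) = lunit C' (Fo A)"
    and phi_runit: "A \<in> Obj C
      \<Longrightarrow> Fa (runit C A) \<cdot>\<^bsub>C'\<^esub> \<phi> A \<one>\<^bsub>C\<^esub> \<cdot>\<^bsub>C'\<^esub> (Ide C' (Fo A) \<boxtimes>\<^bsub>C'\<^esub> \<phi>0) = runit C' (Fo A)"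

locale monoidal_transformation =
  natural_transformation C C' Fo Fa Ho Ha \<tau> +
  F: monoidal_functor C C' Fo Fa \<phi> \<phi>0 + H: monoidal_functor C C' Ho Ha \<psi> \<psi>0
  for C :: "('o, 'm, 'x) moncat_scheme"
    and C' :: "('o2, 'm2, 'y) moncat_scheme"
    and Fo Fa \<phi> \<phi>0 Ho Ha \<psi> \<psi>0 \<tau> +
  assumes tensor_compat: "A \<in> Obj C \<Longrightarrow> B \<in> Obj C
      \<Longrightarrow> \<tau> (A \<otimes>\<^bsub>C\<^esub> B) \<cdot>\<^bsub>C'\<^esub> \<phi> A B = \<psi> A B \<cdot>\<^bsub>C'\<^esub> (\<tau> A \<boxtimes>\<^bsub>C'\<^esub> \<tau> B)"
    and unit_compat: "\<tau> \<one>\<^bsub>C\<^esub> \<cdot>\<^bsub>C'\<^esub> \<phi>0 = \<psi>0"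


section \<open>Monoidal comonads and their coalgebras\<close>

locale monoidal_comonad =
  monoidal_functor C C Go Ga \<phi> \<phi>0 +
  comult: monoidal_transformation C C Go Ga \<phi> \<phi>0
    "\<lambda>A. Go (Go A)" "\<lambda>f. Ga (Ga f)"
    "\<lambda>A B. Ga (\<phi> A B) \<cdot>\<^bsub>C\<^esub> \<phi> (Go A) (Go B)" "Ga \<phi>0 \<cdot>\<^bsub>C\<^esub> \<phi>0" \<delta> +
  counit: monoidal_transformation C C Go Ga \<phi> \<phi>0
    "\<lambda>A. A" "\<lambda>f. f" "\<lambda>A B. Ide C (A \<otimes>\<^bsub>C\<^esub> B)" "Ide C \<one>\<^bsub>C\<^esub>" \<epsilon>
  for C :: "('o, 'm, 'x) moncat_scheme"
    and Go :: "'o \<Rightarrow> 'o" and Ga :: "'m \<Rightarrow> 'm"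
    and \<phi> :: "'o \<Rightarrow> 'o \<Rightarrow> 'm" and \<phi>0 :: "'m"
    and \<delta> :: "'o \<Rightarrow> 'm" and \<epsilon> :: "'o \<Rightarrow> 'm" +
  assumes counit_left: "A \<in> Obj C \<Longrightarrow> \<epsilon> (Go A) \<cdot>\<^bsub>C\<^esub> \<delta> A = Ide C (Go A)"
    and counit_right: "A \<in> Obj C \<Longrightarrow> Ga (\<epsilon> A) \<cdot>\<^bsub>C\<^esub> \<delta> A = Ide C (Go A)"
    and coassoc: "A \<in> Obj C \<Longrightarrow> \<delta> (Go A) \<cdot>\<^bsub>C\<^esub> \<delta> A = Ga (\<delta> A) \<cdot>\<^bsub>C\<^esub> \<delta> A"

definition coalgebras ::
  "('o, 'm, 'x) moncat_scheme \<Rightarrow> ('o \<Rightarrow> 'o) \<Rightarrow> ('m \<Rightarrow> 'm) \<Rightarrow> ('o \<Rightarrow> 'm) \<Rightarrow> ('o \<Rightarrow> 'm)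
   \<Rightarrow> ('o \<times> 'm) set" where
  "coalgebras C Go Ga \<delta> \<epsilon> = {(A, \<gamma>). A \<in> Obj C \<and> \<gamma> \<in> hom C A (Go A) \<and>
     \<epsilon> A \<cdot>\<^bsub>C\<^esub> \<gamma> = Ide C A \<and> \<delta> A \<cdot>\<^bsub>C\<^esub> \<gamma> = Ga \<gamma> \<cdot>\<^bsub>C\<^esub> \<gamma>}"

text \<open>
  An arrow of the category of coalgebras is a triple \<open>(X, f, Y)\<close> consisting of its domain,
  the underlying arrow and its codomain.
\<close>

type_synonym ('o, 'm) coalg_arr = "('o \<times> 'm) \<times> 'm \<times> ('o \<times> 'm)"

definition coalgebra_morphisms ::
  "('o, 'm, 'x) moncat_scheme \<Rightarrow> ('o \<Rightarrow> 'o) \<Rightarrow> ('m \<Rightarrow> 'm) \<Rightarrow> ('o \<Rightarrow> 'm) \<Rightarrow> ('o \<Rightarrow> 'm)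
   \<Rightarrow> ('o, 'm) coalg_arr set" where
  "coalgebra_morphisms C Go Ga \<delta> \<epsilon> = {((A, \<gamma>), f, (B, \<gamma>')).
     (A, \<gamma>) \<in> coalgebras C Go Ga \<delta> \<epsilon> \<and> (B, \<gamma>') \<in> coalgebras C Go Ga \<delta> \<epsilon> \<and>
     f \<in> hom C A B \<and> \<gamma>' \<cdot>\<^bsub>C\<^esub> f = Ga f \<cdot>\<^bsub>C\<^esub> \<gamma>}"

definition coalgebra_tensor ::
  "('o, 'm, 'x) moncat_scheme \<Rightarrow> ('o \<Rightarrow> 'o \<Rightarrow> 'm) \<Rightarrow> 'o \<times> 'm \<Rightarrow> 'o \<times> 'm \<Rightarrow> 'o \<times> 'm" where
  "coalgebra_tensor C \<phi> X Y =
     (fst X \<otimes>\<^bsub>C\<^esub> fst Y, \<phi> (fst X) (fst Y) \<cdot>\<^bsub>C\<^esub> (snd X \<boxtimes>\<^bsub>C\<^esub> snd Y))"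

definition coalgebra_category ::
  "('o, 'm, 'x) moncat_scheme \<Rightarrow> ('o \<Rightarrow> 'o) \<Rightarrow> ('m \<Rightarrow> 'm) \<Rightarrow> ('o \<Rightarrow> 'o \<Rightarrow> 'm) \<Rightarrow> 'm
   \<Rightarrow> ('o \<Rightarrow> 'm) \<Rightarrow> ('o \<Rightarrow> 'm) \<Rightarrow> ('o \<times> 'm, ('o, 'm) coalg_arr) moncat" where
  "coalgebra_category C Go Ga \<phi> \<phi>0 \<delta> \<epsilon> =
    (let T = coalgebra_tensor C \<phi> in
     \<lparr>Obj = coalgebras C Go Ga \<delta> \<epsilon>,
      Arr = coalgebra_morphisms C Go Ga \<delta> \<epsilon>,
      Dom = (\<lambda>(X, f, Y). X),
      Cod = (\<lambda>(X, f, Y). Y),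
      Ide = (\<lambda>X. (X, Ide C (fst X), X)),
      Comp = (\<lambda>(Y, g, Z) (X, f, Y'). (X, g \<cdot>\<^bsub>C\<^esub> f, Z)),
      tensor_obj = T,
      tensor_arr = (\<lambda>(X, f, Y) (X', g, Y'). (T X X', f \<boxtimes>\<^bsub>C\<^esub> g, T Y Y')),
      unit_obj = (\<one>\<^bsub>C\<^esub>, \<phi>0),
      assoc = (\<lambda>X Y Z. (T (T X Y) Z, assoc C (fst X) (fst Y) (fst Z), T X (T Y Z))),
      lunit = (\<lambda>X. (T (\<one>\<^bsub>C\<^esub>, \<phi>0) X, lunit C (fst X), X)),
      runit = (\<lambda>X. (T X (\<one>\<^bsub>C\<^esub>, \<phi>0), runit C (fst X), X))\<rparr>)"


section \<open>Left raisers\<close>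

text \<open>
  \<open>So B\<close> is the chosen object written \<open>S B\<close>, and \<open>varpi A B\<close> is the bijection
  \<open>C(A, S B) \<rightarrow> C(A \<otimes> B, D)\<close>. The last two assumptions are the normalisation of the choice
  for \<open>B = I\<close>; in the absence of strictness, the requirement that \<open>varpi A I\<close> be the
  identity means that it is precomposition with the right unit constraint.
\<close>

locale left_raising = monoidal_category C
  for C :: "('o, 'm, 'x) moncat_scheme" (structure) +
  fixes D :: 'o and So :: "'o \<Rightarrow> 'o" and varpi :: "'o \<Rightarrow> 'o \<Rightarrow> 'm \<Rightarrow> 'm"
  assumes D_Obj: "D \<in> Obj C"
    and So_Obj: "B \<in> Obj C \<Longrightarrow> So B \<in> Obj C"
    and varpi_bij: "A \<in> Obj C \<Longrightarrow> B \<in> Obj C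
      \<Longrightarrow> bij_betw (varpi A B) (hom C A (So B)) (hom C (A \<otimes> B) D)"
    and varpi_natural: "B \<in> Obj C \<Longrightarrow> f \<in> hom C A' A \<Longrightarrow> g \<in> hom C A (So B)
      \<Longrightarrow> varpi A' B (g \<cdot> f) = varpi A B g \<cdot> (f \<boxtimes> Ide C B)"
    and So_unit: "So \<one> = D"
    and varpi_unit: "A \<in> Obj C \<Longrightarrow> g \<in> hom C A D \<Longrightarrow> varpi A \<one> g = g \<cdot> runit C A"

definition left_raiser :: "('o, 'm, 'x) moncat_scheme \<Rightarrow> 'o \<Rightarrow> bool" where
  "left_raiser C D \<longleftrightarrow> (\<exists>So varpi. left_raising C D So varpi)"

text \<open>
  The functor \<open>S\<close> from the opposite category associated with a left raiser. Its action
  \<open>Sa\<close> on arrows is determined by naturality of \<open>varpi A B\<close> in \<open>B\<close>.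
\<close>

locale left_raising_functor =
  left_raising C D So varpi + S: cat_functor "op_cat C" C So Sa
  for C :: "('o, 'm, 'x) moncat_scheme" (structure)
    and D :: 'o and So :: "'o \<Rightarrow> 'o" and Sa :: "'m \<Rightarrow> 'm"
    and varpi :: "'o \<Rightarrow> 'o \<Rightarrow> 'm \<Rightarrow> 'm" +
  assumes varpi_natural_right: "A \<in> Obj C \<Longrightarrow> h \<in> hom C B' B \<Longrightarrow> g \<in> hom C A (So B)
      \<Longrightarrow> varpi A B' (Sa h \<cdot> g) = varpi A B g \<cdot> (Ide C A \<boxtimes> h)"

definition raise_omega ::
  "('o, 'm, 'x) moncat_scheme \<Rightarrow> ('o \<Rightarrow> 'o) \<Rightarrow> ('o \<Rightarrow> 'o \<Rightarrow> 'm \<Rightarrow> 'm)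
   \<Rightarrow> 'o \<Rightarrow> 'o \<Rightarrow> 'o \<Rightarrow> 'm \<Rightarrow> 'm" where
  "raise_omega C So varpi A B E f =
     inv_into (hom C (A \<otimes>\<^bsub>C\<^esub> B) (So E)) (varpi (A \<otimes>\<^bsub>C\<^esub> B) E)
       (varpi A (B \<otimes>\<^bsub>C\<^esub> E) f \<cdot>\<^bsub>C\<^esub> assoc C A B E)"

definition raise_e ::
  "('o, 'm, 'x) moncat_scheme \<Rightarrow> ('o \<Rightarrow> 'o) \<Rightarrow> ('o \<Rightarrow> 'o \<Rightarrow> 'm \<Rightarrow> 'm) \<Rightarrow> 'o \<Rightarrow> 'o \<Rightarrow> 'm" where
  "raise_e C So varpi B E =
     raise_omega C So varpi (So (B \<otimes>\<^bsub>C\<^esub> E)) B E (Ide C (So (B \<otimes>\<^bsub>C\<^esub> E)))"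

definition raise_rho ::
  "('o, 'm, 'x) moncat_scheme \<Rightarrow> ('o \<Rightarrow> 'o) \<Rightarrow> ('o \<Rightarrow> 'o \<Rightarrow> 'm \<Rightarrow> 'm)
   \<Rightarrow> 'o \<Rightarrow> 'o \<Rightarrow> 'm \<Rightarrow> 'm" where
  "raise_rho C So varpi A B f =
     inv_into (hom C \<one>\<^bsub>C\<^esub> (So (A \<otimes>\<^bsub>C\<^esub> B))) (raise_omega C So varpi \<one>\<^bsub>C\<^esub> A B)
       (f \<cdot>\<^bsub>C\<^esub> lunit C A)"

definition raise_n ::
  "('o, 'm, 'x) moncat_scheme \<Rightarrow> ('o \<Rightarrow> 'o) \<Rightarrow> ('o \<Rightarrow> 'o \<Rightarrow> 'm \<Rightarrow> 'm) \<Rightarrow> 'o \<Rightarrow> 'm" where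
  "raise_n C So varpi B = raise_rho C So varpi (So B) B (Ide C (So B))"

text \<open>
  The morphism \<open>n\<^sub>I : I \<rightarrow> S(S I \<otimes> I)\<close>, transported along \<open>S(S I \<otimes> I) \<cong> S(S I)\<close>.
\<close>

definition raise_n_unit ::
  "('o, 'm, 'x) moncat_scheme \<Rightarrow> ('o \<Rightarrow> 'o) \<Rightarrow> ('m \<Rightarrow> 'm) \<Rightarrow> ('o \<Rightarrow> 'o \<Rightarrow> 'm \<Rightarrow> 'm) \<Rightarrow> 'm" where
  "raise_n_unit C So Sa varpi =
     Sa (inverse_arr C (runit C (So \<one>\<^bsub>C\<^esub>))) \<cdot>\<^bsub>C\<^esub> raise_n C So varpi \<one>\<^bsub>C\<^esub>"

end

theory Submission
  imports Defs
begin

text \<open>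
  A left raiser is a representing object: \<open>varpi\<close> is determined by the evaluations
  \<open>ev B : S B \<otimes> B \<rightarrow> D\<close> through \<open>varpi f = ev B \<cdot> (f \<boxtimes> 1)\<close>. The structure on coalgebras is lifted
  from \<open>C\<close>: for a coalgebra \<open>Y = (B, \<beta>)\<close>, the object \<open>S B\<close> with coaction
  \<open>GS(\<beta>) \<cdot> \<nu> B\<close> is a coalgebra \<open>EM_S Y\<close>, by the first two axioms (\<open>EM_S_object\<close>). Taking
  \<open>Y\<close> to be the unit coalgebra gives exactly the coaction on \<open>D\<close> in the theorem.

  The bijection for coalgebras is the restriction of \<open>varpi\<close>. What has to be shown is therefore
  that \<open>f : A \<rightarrow> S B\<close> is a coalgebra morphism if and only if \<open>varpi f : A \<otimes> B \<rightarrow> D\<close> is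
  (\<open>EM_varpi_iff\<close>). Both directions express one arrow in terms of the other by composing and
  tensoring with arrows that are coalgebra morphisms:

  \<^item> \<open>varpi f = ev B \<cdot> (f \<boxtimes> 1)\<close>, where \<open>ev B\<close> is, up to constraints of the monoidal category, the
    arrow \<open>e\<close> with target \<open>S I = D\<close> (\<open>ev_e_unit\<close>). The third axiom says that all arrows \<open>e\<close>
    underlie coalgebra morphisms (\<open>EM_e_hom\<close>).
  \<^item> \<open>f\<close> is recovered from \<open>g = varpi f\<close> as
    \<open>A \<cong> I \<otimes> A \<rightarrow> S D \<otimes> A \<rightarrow> S (A \<otimes> B) \<otimes> A \<rightarrow> S B\<close>, the arrows being \<open>n\<^sub>I \<boxtimes> 1\<close>, \<open>S g \<boxtimes> 1\<close>
    and \<open>e\<close> (\<open>ev_transpose\<close>). The fourth axiom says precisely that \<open>n\<^sub>I\<close> is a coalgebra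
    morphism into \<open>EM_S\<close> of the coalgebra \<open>D\<close>, and \<open>S g\<close> is one because \<open>EM_S\<close> is a functor.

  Since \<open>C\<close> is not strict, the formula for \<open>f\<close> rests on the coherence law
  \<open>lunit_tensor\<close>, which is derived from the pentagon and the triangle.
\<close>

section \<open>Calculating in categories and monoidal categories\<close>

text \<open>
  Equations between arrows are proved by rewriting. Typing is phrased with \<open>Arr\<close>, \<open>Dom\<close> and
  \<open>Cod\<close> rather than with \<open>hom\<close>, so that the simplifier computes the domain and codomain of a
  composite instead of having to guess the intermediate objects.
\<close>

context category
begin

lemma hom_iff: "f \<in> hom C A B \<longleftrightarrow> f \<in> Arr C \<and> Dom C f = A \<and> Cod C f = B"
  by (simp add: hom_def)

lemma hom_Objs:
  assumes "f \<in> hom C A B"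
  shows "A \<in> Obj C" and "B \<in> Obj C"
  using assms Dom_Obj Cod_Obj by (auto simp: hom_def)

lemma Ide_typing [simp]:
  assumes "A \<in> Obj C"
  shows "Ide C A \<in> Arr C" and "Dom C (Ide C A) = A" and "Cod C (Ide C A) = A"
  using Id_hom[OF assms] by (simp_all add: hom_iff)

lemma Comp_typing [simp]:
  assumes "f \<in> Arr C" and "g \<in> Arr C" and "Cod C f = Dom C g"
  shows "g \<cdot> f \<in> Arr C" and "Dom C (g \<cdot> f) = Dom C f" and "Cod C (g \<cdot> f) = Cod C g"
  using Comp_hom[of f "Dom C f" "Cod C f" g "Cod C g"] assms by (simp_all add: hom_iff)

lemma Comp_Ide_Dom [simp]: "f \<in> Arr C \<Longrightarrow> Dom C f = A \<Longrightarrow> f \<cdot> Ide C A = f"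
  by (rule Comp_Id) (auto simp: hom_iff)

lemma Ide_Cod_Comp [simp]: "f \<in> Arr C \<Longrightarrow> Cod C f = A \<Longrightarrow> Ide C A \<cdot> f = f"
  by (rule Id_Comp) (auto simp: hom_iff)

lemma Comp_reassoc [simp]:
  assumes "f \<in> Arr C" and "g \<in> Arr C" and "h \<in> Arr C"
    and "Cod C f = Dom C g" and "Cod C g = Dom C h"
  shows "(h \<cdot> g) \<cdot> f = h \<cdot> g \<cdot> f"
  using Comp_assoc[of f "Dom C f" "Cod C f" g "Cod C g" h "Cod C h"] assms
  by (simp add: hom_iff)

text \<open>
  In composites associated to the right, the left-hand side of a commuting square \<open>g \<cdot> f = k\<close>
  does not occur as a subterm when further arrows follow on the right. This rule applies the square
  nevertheless.
\<close>

lemma Comp_extend: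
  assumes "g \<cdot> f = k" and "f \<in> Arr C" and "g \<in> Arr C" and "x \<in> Arr C"
    and "Cod C x = Dom C f" and "Cod C f = Dom C g"
  shows "g \<cdot> f \<cdot> x = k \<cdot> x"
proof -
  have "g \<cdot> f \<cdot> x = (g \<cdot> f) \<cdot> x"
    using assms(2-6) by (intro Comp_reassoc[symmetric]) simp_all
  then show ?thesis
    by (simp only: assms(1))
qed

lemma inverse_arrows_unique:
  assumes g: "inverse_arrows C f g" and h: "inverse_arrows C f h"
  shows "h = g"
proof -
  have "h = h \<cdot> f \<cdot> g"
    using g h by (simp add: inverse_arrows_def hom_iff)
  also have "\<dots> = (h \<cdot> f) \<cdot> g"
    using g h by (intro Comp_reassoc[symmetric]) (simp_all add: inverse_arrows_def hom_iff)
  also have "\<dots> = g"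
    using g h by (simp add: inverse_arrows_def hom_iff)
  finally show ?thesis .
qed

lemma inverse_arrows_inverse_arr:
  assumes "iso C f"
  shows "inverse_arrows C f (inverse_arr C f)"
proof -
  obtain g where g: "inverse_arrows C f g"
    using assms by (auto simp: iso_def)
  show ?thesis
    unfolding inverse_arr_def by (rule theI[of "inverse_arrows C f", OF g inverse_arrows_unique[OF g]])
qed

lemma inverse_arr_of_iso:
  assumes "iso C f" and "f \<in> hom C A B"
  shows "inverse_arr C f \<in> hom C B A"
    and "inverse_arr C f \<cdot> f = Ide C A"
    and "f \<cdot> inverse_arr C f = Ide C B"
  using inverse_arrows_inverse_arr[OF assms(1)] assms(2)
  by (auto simp: inverse_arrows_def hom_iff)

lemma iso_cancel_right:
  assumes "iso C h" and "h \<in> Arr C" and "f \<in> Arr C" and "g \<in> Arr C"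
    and "Dom C f = Cod C h" and "Dom C g = Cod C h" and "f \<cdot> h = g \<cdot> h"
  shows "f = g"
proof -
  note inv = inverse_arr_of_iso[OF assms(1), of "Dom C h" "Cod C h"]
  have "(k \<cdot> h) \<cdot> inverse_arr C h = k" if "k \<in> Arr C" and "Dom C k = Cod C h" for k
    using assms(1,2) inv that by (simp add: hom_iff)
  then show ?thesis
    using assms(3-7) by metis
qed

end

lemma op_cat_simps [simp]:
  "Obj (op_cat C) = Obj C" "Ide (op_cat C) = Ide C"
  "hom (op_cat C) A B = hom C B A" "Comp (op_cat C) g f = f \<cdot>\<^bsub>C\<^esub> g"
  by (auto simp: op_cat_def hom_def)

context monoidal_category
begin

lemmas monoidal_Obj [simp] = tensor_Obj unit_Obj

lemma tensor_typing [simp]: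
  assumes "f \<in> Arr C" and "g \<in> Arr C"
  shows "f \<boxtimes> g \<in> Arr C" and "Dom C (f \<boxtimes> g) = Dom C f \<otimes> Dom C g"
    and "Cod C (f \<boxtimes> g) = Cod C f \<otimes> Cod C g"
  using tensor_hom[of f "Dom C f" "Cod C f" g "Dom C g" "Cod C g"] assms by (simp_all add: hom_iff)

lemma assoc_typing [simp]:
  assumes "A \<in> Obj C" and "B \<in> Obj C" and "E \<in> Obj C"
  shows "assoc C A B E \<in> Arr C" and "Dom C (assoc C A B E) = (A \<otimes> B) \<otimes> E"
    and "Cod C (assoc C A B E) = A \<otimes> B \<otimes> E"
  using assoc_hom[OF assms] by (simp_all add: hom_iff)

lemma unit_typing [simp]:
  assumes "A \<in> Obj C"
  shows "lunit C A \<in> Arr C" and "Dom C (lunit C A) = \<one> \<otimes> A" and "Cod C (lunit C A) = A"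
    and "runit C A \<in> Arr C" and "Dom C (runit C A) = A \<otimes> \<one>" and "Cod C (runit C A) = A"
  using lunit_hom[OF assms] runit_hom[OF assms] by (simp_all add: hom_iff)

lemma tensor_Comp [simp]:
  assumes "f \<in> Arr C" and "f' \<in> Arr C" and "g \<in> Arr C" and "g' \<in> Arr C"
    and "Cod C f = Dom C f'" and "Cod C g = Dom C g'"
  shows "(f' \<boxtimes> g') \<cdot> (f \<boxtimes> g) = (f' \<cdot> f) \<boxtimes> (g' \<cdot> g)"
  using interchange[of f "Dom C f" "Dom C f'" f' "Cod C f'" g "Dom C g" "Dom C g'" g' "Cod C g'"]
    assms by (simp add: hom_iff)

lemma tensor_Comp_extend [simp]:
  assumes "f \<in> Arr C" and "f' \<in> Arr C" and "g \<in> Arr C" and "g' \<in> Arr C" and "x \<in> Arr C"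
    and "Cod C f = Dom C f'" and "Cod C g = Dom C g'" and "Cod C x = Dom C f \<otimes> Dom C g"
  shows "(f' \<boxtimes> g') \<cdot> (f \<boxtimes> g) \<cdot> x = ((f' \<cdot> f) \<boxtimes> (g' \<cdot> g)) \<cdot> x"
  using assms by (intro Comp_extend) simp_all

lemmas tensor_Ide [simp] = tensor_Id

lemma assoc_nat:
  assumes "f \<in> Arr C" and "g \<in> Arr C" and "h \<in> Arr C"
    and "Cod C f = A" and "Cod C g = B" and "Cod C h = E"
  shows "assoc C A B E \<cdot> ((f \<boxtimes> g) \<boxtimes> h) = (f \<boxtimes> g \<boxtimes> h) \<cdot> assoc C (Dom C f) (Dom C g) (Dom C h)"
  using assoc_natural[of f "Dom C f" A g "Dom C g" B h "Dom C h" E] assms by (simp add: hom_iff)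

lemma lunit_nat:
  "f \<in> Arr C \<Longrightarrow> Cod C f = B \<Longrightarrow> lunit C B \<cdot> (Ide C \<one> \<boxtimes> f) = f \<cdot> lunit C (Dom C f)"
  using lunit_natural[of f "Dom C f" B] by (simp add: hom_iff)

lemma runit_nat:
  "f \<in> Arr C \<Longrightarrow> Cod C f = B \<Longrightarrow> runit C B \<cdot> (f \<boxtimes> Ide C \<one>) = f \<cdot> runit C (Dom C f)"
  using runit_natural[of f "Dom C f" B] by (simp add: hom_iff)

text \<open>
  The functor \<open>I \<otimes> -\<close> is isomorphic to the identity, by naturality of the left unit constraint.
\<close>

lemma tensor_unit_faithful:
  assumes "f \<in> hom C A B" and "g \<in> hom C A B" and "Ide C \<one> \<boxtimes> f = Ide C \<one> \<boxtimes> g"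
  shows "f = g"
proof (rule iso_cancel_right[of "lunit C A"])
  note obj = hom_Objs[OF assms(1)]
  show "f \<cdot> lunit C A = g \<cdot> lunit C A"
    using lunit_natural[OF assms(1)] lunit_natural[OF assms(2)] assms(3) by simp
  show "iso C (lunit C A)"
    using obj by (simp add: lunit_iso)
qed (use assms hom_Objs[OF assms(1)] in \<open>simp_all add: hom_iff\<close>)

lemma tensor_iso:
  assumes "iso C f" and "iso C g"
  shows "iso C (f \<boxtimes> g)"
proof -
  obtain f' g' where "inverse_arrows C f f'" and "inverse_arrows C g g'"
    using assms by (auto simp: iso_def)
  then have "inverse_arrows C (f \<boxtimes> g) (f' \<boxtimes> g')"
    by (auto simp: inverse_arrows_def hom_iff Dom_Obj Cod_Obj)
  then show ?thesis
    by (auto simp: iso_def)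
qed

lemma Ide_iso: "A \<in> Obj C \<Longrightarrow> iso C (Ide C A)"
  by (auto simp: iso_def inverse_arrows_def hom_iff intro!: exI[of _ "Ide C A"])

text \<open>
  Kelly's derivation of the second unit law: by faithfulness of \<open>I \<otimes> -\<close> it is enough to prove it
  after tensoring with \<open>I\<close> on the left. There the pentagon for \<open>I, I, A, B\<close> and two
  instances of the triangle compare both sides, after composition with associativity
  isomorphisms that are cancelled at the end.
\<close>

lemma lunit_tensor:
  assumes A: "A \<in> Obj C" and B: "B \<in> Obj C"
  shows "lunit C (A \<otimes> B) \<cdot> assoc C \<one> A B = lunit C A \<boxtimes> Ide C B"
proof (rule tensor_unit_faithful)
  let ?I = "\<one>" and ?a = "assoc C" and ?id = "Ide C"
  have "(?id ?I \<boxtimes> (lunit C (A \<otimes> B) \<cdot> ?a ?I A B)) \<cdot> ?a ?I (?I \<otimes> A) B \<cdot> (?a ?I ?I A \<boxtimes> ?id B)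
    = (?id ?I \<boxtimes> lunit C (A \<otimes> B)) \<cdot> (?id ?I \<boxtimes> ?a ?I A B) \<cdot> ?a ?I (?I \<otimes> A) B \<cdot> (?a ?I ?I A \<boxtimes> ?id B)"
    using A B by simp
  also have "\<dots> = (?id ?I \<boxtimes> lunit C (A \<otimes> B)) \<cdot> ?a ?I ?I (A \<otimes> B) \<cdot> ?a (?I \<otimes> ?I) A B"
    using A B by (simp only: pentagon unit_Obj)
  also have "\<dots> = (runit C ?I \<boxtimes> ?id (A \<otimes> B)) \<cdot> ?a (?I \<otimes> ?I) A B"
    using A B triangle[of ?I "A \<otimes> B"] by (intro Comp_extend) simp_all
  also have "\<dots> = ?a ?I A B \<cdot> ((runit C ?I \<boxtimes> ?id A) \<boxtimes> ?id B)"
    using A B by (simp add: assoc_nat)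
  also have "\<dots> = ?a ?I A B \<cdot> ((?id ?I \<boxtimes> lunit C A) \<boxtimes> ?id B) \<cdot> (?a ?I ?I A \<boxtimes> ?id B)"
    using A B by (simp add: triangle)
  also have "\<dots> = ((?id ?I \<boxtimes> lunit C A \<boxtimes> ?id B) \<cdot> ?a ?I (?I \<otimes> A) B) \<cdot> (?a ?I ?I A \<boxtimes> ?id B)"
    using A B assoc_nat[of "?id ?I" "lunit C A" "?id B" ?I A B] by (intro Comp_extend) simp_all
  also have "\<dots> = (?id ?I \<boxtimes> lunit C A \<boxtimes> ?id B) \<cdot> ?a ?I (?I \<otimes> A) B \<cdot> (?a ?I ?I A \<boxtimes> ?id B)"
    using A B by simp
  finally have eq: "((?id ?I \<boxtimes> (lunit C (A \<otimes> B) \<cdot> ?a ?I A B)) \<cdot> ?a ?I (?I \<otimes> A) B) \<cdot> (?a ?I ?I A \<boxtimes> ?id B)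
     = ((?id ?I \<boxtimes> lunit C A \<boxtimes> ?id B) \<cdot> ?a ?I (?I \<otimes> A) B) \<cdot> (?a ?I ?I A \<boxtimes> ?id B)"
    using A B by simp
  have "(?id ?I \<boxtimes> (lunit C (A \<otimes> B) \<cdot> ?a ?I A B)) \<cdot> ?a ?I (?I \<otimes> A) B
      = (?id ?I \<boxtimes> lunit C A \<boxtimes> ?id B) \<cdot> ?a ?I (?I \<otimes> A) B"
    by (rule iso_cancel_right[OF _ _ _ _ _ _ eq]) (use A B in \<open>simp_all add: tensor_iso assoc_iso Ide_iso\<close>)
  then show "?id ?I \<boxtimes> (lunit C (A \<otimes> B) \<cdot> ?a ?I A B) = ?id ?I \<boxtimes> lunit C A \<boxtimes> ?id B"
    by (rule iso_cancel_right[rotated 6]) (use A B in \<open>simp_all add: assoc_iso\<close>)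
qed (use A B in \<open>simp_all add: hom_iff\<close>)

text \<open>
  The instance of \<open>r = (1 \<boxtimes> r) \<cdot> a\<close> needed to relate \<open>n\<^sub>I\<close>, defined through \<open>S (D \<otimes> I)\<close>, to
  \<open>S D\<close>. Composition with \<open>lunit C A\<close> on the left reduces it to \<open>lunit_tensor\<close> and naturality.
\<close>

lemma runit_tensor_unit:
  assumes A: "A \<in> Obj C"
  shows "lunit C A \<cdot> runit C (\<one> \<otimes> A) = lunit C A \<cdot> (Ide C \<one> \<boxtimes> runit C A) \<cdot> assoc C \<one> A \<one>"
proof -
  have "lunit C A \<cdot> runit C (\<one> \<otimes> A) = runit C A \<cdot> (lunit C A \<boxtimes> Ide C \<one>)"
    using A by (simp add: runit_nat)
  also have "\<dots> = runit C A \<cdot> lunit C (A \<otimes> \<one>) \<cdot> assoc C \<one> A \<one>"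
    using A by (simp add: lunit_tensor)
  also have "\<dots> = (lunit C A \<cdot> (Ide C \<one> \<boxtimes> runit C A)) \<cdot> assoc C \<one> A \<one>"
    using A lunit_nat[of "runit C A" A] by (intro Comp_extend) simp_all
  finally show ?thesis
    using A by simp
qed

end

section \<open>The monoidal category of coalgebras\<close>

context monoidal_comonad
begin

lemma G_Obj [simp]: "A \<in> Obj C \<Longrightarrow> Go A \<in> Obj C"
  by (rule Fo_Obj)

lemma G_typing [simp]:
  assumes "f \<in> Arr C"
  shows "Ga f \<in> Arr C" and "Dom C (Ga f) = Go (Dom C f)" and "Cod C (Ga f) = Go (Cod C f)"
  using Fa_hom[of f "Dom C f" "Cod C f"] assms by (simp_all add: source.hom_iff)

lemmas G_Ide [simp] = Fa_Id

lemma G_Comp [simp]: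
  "f \<in> Arr C \<Longrightarrow> g \<in> Arr C \<Longrightarrow> Cod C f = Dom C g \<Longrightarrow> Ga (g \<cdot>\<^bsub>C\<^esub> f) = Ga g \<cdot>\<^bsub>C\<^esub> Ga f"
  using Fa_Comp[of f "Dom C f" "Cod C f" g "Cod C g"] by (simp add: source.hom_iff)

lemma phi_typing [simp]:
  assumes "A \<in> Obj C" and "B \<in> Obj C"
  shows "\<phi> A B \<in> Arr C" and "Dom C (\<phi> A B) = Go A \<otimes>\<^bsub>C\<^esub> Go B"
    and "Cod C (\<phi> A B) = Go (A \<otimes>\<^bsub>C\<^esub> B)"
  using phi_hom[OF assms] by (simp_all add: source.hom_iff)

lemma phi0_typing [simp]: "\<phi>0 \<in> Arr C" "Dom C \<phi>0 = \<one>\<^bsub>C\<^esub>" "Cod C \<phi>0 = Go \<one>\<^bsub>C\<^esub>"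
  using phi0_hom by (simp_all add: source.hom_iff)

lemma delta_typing [simp]:
  assumes "A \<in> Obj C"
  shows "\<delta> A \<in> Arr C" and "Dom C (\<delta> A) = Go A" and "Cod C (\<delta> A) = Go (Go A)"
  using comult.component_hom[OF assms] by (simp_all add: source.hom_iff)

lemma epsilon_typing [simp]:
  assumes "A \<in> Obj C"
  shows "\<epsilon> A \<in> Arr C" and "Dom C (\<epsilon> A) = Go A" and "Cod C (\<epsilon> A) = A"
  using counit.component_hom[OF assms] by (simp_all add: source.hom_iff)

lemma phi_nat:
  "f \<in> Arr C \<Longrightarrow> g \<in> Arr C \<Longrightarrow> Cod C f = A \<Longrightarrow> Cod C g = B
    \<Longrightarrow> \<phi> A B \<cdot>\<^bsub>C\<^esub> (Ga f \<boxtimes>\<^bsub>C\<^esub> Ga g) = Ga (f \<boxtimes>\<^bsub>C\<^esub> g) \<cdot>\<^bsub>C\<^esub> \<phi> (Dom C f) (Dom C g)"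
  using phi_natural[of f "Dom C f" A g "Dom C g" B] by (simp add: source.hom_iff)

lemma epsilon_nat:
  "f \<in> Arr C \<Longrightarrow> Cod C f = B \<Longrightarrow> \<epsilon> B \<cdot>\<^bsub>C\<^esub> Ga f = f \<cdot>\<^bsub>C\<^esub> \<epsilon> (Dom C f)"
  using counit.naturality[of f "Dom C f" B] by (simp add: source.hom_iff)

lemma delta_nat:
  "f \<in> Arr C \<Longrightarrow> Cod C f = B \<Longrightarrow> \<delta> B \<cdot>\<^bsub>C\<^esub> Ga f = Ga (Ga f) \<cdot>\<^bsub>C\<^esub> \<delta> (Dom C f)"
  using comult.naturality[of f "Dom C f" B] by (simp add: source.hom_iff)

abbreviation EM_objects :: "('o \<times> 'm) set" where
  "EM_objects \<equiv> coalgebras C Go Ga \<delta> \<epsilon>"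

abbreviation EM_tensor :: "'o \<times> 'm \<Rightarrow> 'o \<times> 'm \<Rightarrow> 'o \<times> 'm"  (infixr "\<odot>" 75) where
  "X \<odot> Y \<equiv> coalgebra_tensor C \<phi> X Y"

abbreviation EM_unit :: "'o \<times> 'm" where
  "EM_unit \<equiv> (\<one>\<^bsub>C\<^esub>, \<phi>0)"

text \<open>
  The arrows \<open>f\<close> of \<open>C\<close> that underlie a coalgebra morphism, so that calculations can stay
  in \<open>C\<close>.
\<close>

definition EM_hom :: "'o \<times> 'm \<Rightarrow> 'o \<times> 'm \<Rightarrow> 'm set" where
  "EM_hom X Y = {f. (X, f, Y) \<in> coalgebra_morphisms C Go Ga \<delta> \<epsilon>}"

lemma EM_objects_iff:
  "X \<in> EM_objects \<longleftrightarrow> fst X \<in> Obj C \<and> snd X \<in> Arr C \<and> Dom C (snd X) = fst X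
    \<and> Cod C (snd X) = Go (fst X) \<and> \<epsilon> (fst X) \<cdot>\<^bsub>C\<^esub> snd X = Ide C (fst X)
    \<and> \<delta> (fst X) \<cdot>\<^bsub>C\<^esub> snd X = Ga (snd X) \<cdot>\<^bsub>C\<^esub> snd X"
  by (cases X) (auto simp: coalgebras_def source.hom_iff)

lemma EM_object_typing [simp]:
  assumes "X \<in> EM_objects"
  shows "fst X \<in> Obj C" and "snd X \<in> Arr C" and "Dom C (snd X) = fst X"
    and "Cod C (snd X) = Go (fst X)"
  using assms by (simp_all add: EM_objects_iff)

lemma EM_object_laws:
  assumes "X \<in> EM_objects"
  shows "\<epsilon> (fst X) \<cdot>\<^bsub>C\<^esub> snd X = Ide C (fst X)"
    and "\<delta> (fst X) \<cdot>\<^bsub>C\<^esub> snd X = Ga (snd X) \<cdot>\<^bsub>C\<^esub> snd X"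
  using assms by (simp_all add: EM_objects_iff del: EM_object_typing)

lemma EM_hom_iff:
  "f \<in> EM_hom X Y \<longleftrightarrow> X \<in> EM_objects \<and> Y \<in> EM_objects \<and> f \<in> Arr C \<and> Dom C f = fst X
    \<and> Cod C f = fst Y \<and> snd Y \<cdot>\<^bsub>C\<^esub> f = Ga f \<cdot>\<^bsub>C\<^esub> snd X"
  by (cases X; cases Y) (auto simp: EM_hom_def coalgebra_morphisms_def source.hom_iff)

lemma EM_tensor_sel [simp]:
  "fst (X \<odot> Y) = fst X \<otimes>\<^bsub>C\<^esub> fst Y"
  "snd (X \<odot> Y) = \<phi> (fst X) (fst Y) \<cdot>\<^bsub>C\<^esub> (snd X \<boxtimes>\<^bsub>C\<^esub> snd Y)"
  by (simp_all add: coalgebra_tensor_def)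

text \<open>
  Monoidality of \<open>\<epsilon>\<close> gives the counit law and monoidality of \<open>\<delta>\<close> the coassociativity law of the
  tensor product.
\<close>

lemma EM_tensor_object:
  assumes X: "X \<in> EM_objects" and Y: "Y \<in> EM_objects"
  shows "X \<odot> Y \<in> EM_objects"
proof -
  obtain A \<alpha> B \<beta> where XY: "X = (A, \<alpha>)" "Y = (B, \<beta>)"
    by (cases X; cases Y)
  note [simp] = EM_object_typing[OF X, unfolded XY fst_conv snd_conv]
    EM_object_typing[OF Y, unfolded XY fst_conv snd_conv]
  note laws = EM_object_laws[OF X, unfolded XY fst_conv snd_conv]
    EM_object_laws[OF Y, unfolded XY fst_conv snd_conv]
  have "\<epsilon> (A \<otimes>\<^bsub>C\<^esub> B) \<cdot>\<^bsub>C\<^esub> \<phi> A B \<cdot>\<^bsub>C\<^esub> (\<alpha> \<boxtimes>\<^bsub>C\<^esub> \<beta>)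
      = (\<epsilon> A \<boxtimes>\<^bsub>C\<^esub> \<epsilon> B) \<cdot>\<^bsub>C\<^esub> (\<alpha> \<boxtimes>\<^bsub>C\<^esub> \<beta>)"
    using counit.tensor_compat[of A B] by (intro source.Comp_extend) simp_all
  also have "\<dots> = Ide C (A \<otimes>\<^bsub>C\<^esub> B)"
    by (simp add: laws)
  finally have unit: "\<epsilon> (A \<otimes>\<^bsub>C\<^esub> B) \<cdot>\<^bsub>C\<^esub> \<phi> A B \<cdot>\<^bsub>C\<^esub> (\<alpha> \<boxtimes>\<^bsub>C\<^esub> \<beta>) = Ide C (A \<otimes>\<^bsub>C\<^esub> B)" .
  have "\<delta> (A \<otimes>\<^bsub>C\<^esub> B) \<cdot>\<^bsub>C\<^esub> \<phi> A B \<cdot>\<^bsub>C\<^esub> (\<alpha> \<boxtimes>\<^bsub>C\<^esub> \<beta>)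
      = (Ga (\<phi> A B) \<cdot>\<^bsub>C\<^esub> \<phi> (Go A) (Go B) \<cdot>\<^bsub>C\<^esub> (\<delta> A \<boxtimes>\<^bsub>C\<^esub> \<delta> B)) \<cdot>\<^bsub>C\<^esub> (\<alpha> \<boxtimes>\<^bsub>C\<^esub> \<beta>)"
    using comult.tensor_compat[of A B] by (intro source.Comp_extend) simp_all
  also have "\<dots> = Ga (\<phi> A B) \<cdot>\<^bsub>C\<^esub> (\<phi> (Go A) (Go B) \<cdot>\<^bsub>C\<^esub> (Ga \<alpha> \<boxtimes>\<^bsub>C\<^esub> Ga \<beta>)) \<cdot>\<^bsub>C\<^esub> (\<alpha> \<boxtimes>\<^bsub>C\<^esub> \<beta>)"
    by (simp add: laws)
  also have "\<dots> = Ga (\<phi> A B \<cdot>\<^bsub>C\<^esub> (\<alpha> \<boxtimes>\<^bsub>C\<^esub> \<beta>)) \<cdot>\<^bsub>C\<^esub> \<phi> A B \<cdot>\<^bsub>C\<^esub> (\<alpha> \<boxtimes>\<^bsub>C\<^esub> \<beta>)"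
    by (simp add: phi_nat)
  finally show ?thesis
    using unit by (simp add: XY EM_objects_iff del: EM_object_typing)
qed

lemma EM_unit_object: "EM_unit \<in> EM_objects"
  using counit.unit_compat comult.unit_compat by (simp add: EM_objects_iff del: EM_object_typing)

lemma EM_Ide: "X \<in> EM_objects \<Longrightarrow> Ide C (fst X) \<in> EM_hom X X"
  by (simp add: EM_hom_iff)

lemma EM_Comp:
  assumes f: "f \<in> EM_hom X Y" and g: "g \<in> EM_hom Y Z"
  shows "g \<cdot>\<^bsub>C\<^esub> f \<in> EM_hom X Z"
proof -
  note [simp] = f[unfolded EM_hom_iff] g[unfolded EM_hom_iff]
  have "snd Z \<cdot>\<^bsub>C\<^esub> g \<cdot>\<^bsub>C\<^esub> f = (Ga g \<cdot>\<^bsub>C\<^esub> snd Y) \<cdot>\<^bsub>C\<^esub> f"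
    by (intro source.Comp_extend) simp_all
  also have "\<dots> = Ga (g \<cdot>\<^bsub>C\<^esub> f) \<cdot>\<^bsub>C\<^esub> snd X"
    by simp
  finally show ?thesis
    by (simp add: EM_hom_iff)
qed

lemma EM_tensor_hom:
  assumes f: "f \<in> EM_hom X Y" and g: "g \<in> EM_hom X' Y'"
  shows "f \<boxtimes>\<^bsub>C\<^esub> g \<in> EM_hom (X \<odot> X') (Y \<odot> Y')"
proof -
  note [simp] = f[unfolded EM_hom_iff] g[unfolded EM_hom_iff]
  have "(\<phi> (fst Y) (fst Y') \<cdot>\<^bsub>C\<^esub> (snd Y \<boxtimes>\<^bsub>C\<^esub> snd Y')) \<cdot>\<^bsub>C\<^esub> (f \<boxtimes>\<^bsub>C\<^esub> g)
      = (\<phi> (fst Y) (fst Y') \<cdot>\<^bsub>C\<^esub> (Ga f \<boxtimes>\<^bsub>C\<^esub> Ga g)) \<cdot>\<^bsub>C\<^esub> (snd X \<boxtimes>\<^bsub>C\<^esub> snd X')"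
    by simp
  also have "\<dots> = Ga (f \<boxtimes>\<^bsub>C\<^esub> g) \<cdot>\<^bsub>C\<^esub> \<phi> (fst X) (fst X') \<cdot>\<^bsub>C\<^esub> (snd X \<boxtimes>\<^bsub>C\<^esub> snd X')"
    by (simp add: phi_nat)
  finally show ?thesis
    by (simp add: EM_hom_iff EM_tensor_object)
qed

lemma EM_inverse:
  assumes f: "f \<in> EM_hom X Y" and "iso C f"
  shows "inverse_arr C f \<in> EM_hom Y X"
proof -
  let ?g = "inverse_arr C f"
  note [simp] = f[unfolded EM_hom_iff]
    source.inverse_arrows_inverse_arr[OF assms(2), unfolded inverse_arrows_def source.hom_iff]
  have "Ga ?g \<cdot>\<^bsub>C\<^esub> Ga f = Ide C (Go (fst X))"
    by (simp flip: G_Comp)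
  then have "snd X \<cdot>\<^bsub>C\<^esub> ?g = (Ga ?g \<cdot>\<^bsub>C\<^esub> Ga f) \<cdot>\<^bsub>C\<^esub> snd X \<cdot>\<^bsub>C\<^esub> ?g"
    by simp
  also have "\<dots> = Ga ?g \<cdot>\<^bsub>C\<^esub> (snd Y \<cdot>\<^bsub>C\<^esub> f) \<cdot>\<^bsub>C\<^esub> ?g"
    by simp
  also have "\<dots> = Ga ?g \<cdot>\<^bsub>C\<^esub> snd Y"
    by (subst source.Comp_reassoc) simp_all
  finally show ?thesis
    by (simp add: EM_hom_iff)
qed

lemma EM_assoc:
  assumes X: "X \<in> EM_objects" and Y: "Y \<in> EM_objects" and Z: "Z \<in> EM_objects"
  shows "assoc C (fst X) (fst Y) (fst Z) \<in> EM_hom ((X \<odot> Y) \<odot> Z) (X \<odot> Y \<odot> Z)"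
proof -
  obtain A \<alpha> B \<beta> E \<gamma> where XYZ: "X = (A, \<alpha>)" "Y = (B, \<beta>)" "Z = (E, \<gamma>)"
    by (cases X; cases Y; cases Z)
  note [simp] = EM_object_typing[OF X, unfolded XYZ fst_conv snd_conv]
    EM_object_typing[OF Y, unfolded XYZ fst_conv snd_conv]
    EM_object_typing[OF Z, unfolded XYZ fst_conv snd_conv]
  have "(\<phi> A (B \<otimes>\<^bsub>C\<^esub> E) \<cdot>\<^bsub>C\<^esub> (\<alpha> \<boxtimes>\<^bsub>C\<^esub> (\<phi> B E \<cdot>\<^bsub>C\<^esub> (\<beta> \<boxtimes>\<^bsub>C\<^esub> \<gamma>)))) \<cdot>\<^bsub>C\<^esub> assoc C A B E
      = \<phi> A (B \<otimes>\<^bsub>C\<^esub> E) \<cdot>\<^bsub>C\<^esub> (Ide C (Go A) \<boxtimes>\<^bsub>C\<^esub> \<phi> B E)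
        \<cdot>\<^bsub>C\<^esub> (\<alpha> \<boxtimes>\<^bsub>C\<^esub> \<beta> \<boxtimes>\<^bsub>C\<^esub> \<gamma>) \<cdot>\<^bsub>C\<^esub> assoc C A B E"
    by simp
  also have "\<dots> = \<phi> A (B \<otimes>\<^bsub>C\<^esub> E) \<cdot>\<^bsub>C\<^esub> (Ide C (Go A) \<boxtimes>\<^bsub>C\<^esub> \<phi> B E)
        \<cdot>\<^bsub>C\<^esub> assoc C (Go A) (Go B) (Go E) \<cdot>\<^bsub>C\<^esub> ((\<alpha> \<boxtimes>\<^bsub>C\<^esub> \<beta>) \<boxtimes>\<^bsub>C\<^esub> \<gamma>)"
    by (simp add: source.assoc_nat)
  also have "\<dots> = (\<phi> A (B \<otimes>\<^bsub>C\<^esub> E) \<cdot>\<^bsub>C\<^esub> (Ide C (Go A) \<boxtimes>\<^bsub>C\<^esub> \<phi> B E)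
        \<cdot>\<^bsub>C\<^esub> assoc C (Go A) (Go B) (Go E)) \<cdot>\<^bsub>C\<^esub> ((\<alpha> \<boxtimes>\<^bsub>C\<^esub> \<beta>) \<boxtimes>\<^bsub>C\<^esub> \<gamma>)"
    by simp
  also have "\<dots> = (Ga (assoc C A B E) \<cdot>\<^bsub>C\<^esub> \<phi> (A \<otimes>\<^bsub>C\<^esub> B) E
        \<cdot>\<^bsub>C\<^esub> (\<phi> A B \<boxtimes>\<^bsub>C\<^esub> Ide C (Go E))) \<cdot>\<^bsub>C\<^esub> ((\<alpha> \<boxtimes>\<^bsub>C\<^esub> \<beta>) \<boxtimes>\<^bsub>C\<^esub> \<gamma>)"
    by (subst phi_assoc) simp_all
  also have "\<dots> = Ga (assoc C A B E) \<cdot>\<^bsub>C\<^esub> \<phi> (A \<otimes>\<^bsub>C\<^esub> B) E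
        \<cdot>\<^bsub>C\<^esub> ((\<phi> A B \<cdot>\<^bsub>C\<^esub> (\<alpha> \<boxtimes>\<^bsub>C\<^esub> \<beta>)) \<boxtimes>\<^bsub>C\<^esub> \<gamma>)"
    by simp
  finally show ?thesis
    using X Y Z by (simp add: EM_hom_iff EM_tensor_object XYZ)
qed

lemma EM_lunit:
  assumes X: "X \<in> EM_objects"
  shows "lunit C (fst X) \<in> EM_hom (EM_unit \<odot> X) X"
proof -
  note [simp] = EM_object_typing[OF X]
  have "snd X \<cdot>\<^bsub>C\<^esub> lunit C (fst X)
      = lunit C (Go (fst X)) \<cdot>\<^bsub>C\<^esub> (Ide C \<one>\<^bsub>C\<^esub> \<boxtimes>\<^bsub>C\<^esub> snd X)"
    by (simp add: source.lunit_nat)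
  also have "\<dots> = (Ga (lunit C (fst X)) \<cdot>\<^bsub>C\<^esub> \<phi> \<one>\<^bsub>C\<^esub> (fst X)
      \<cdot>\<^bsub>C\<^esub> (\<phi>0 \<boxtimes>\<^bsub>C\<^esub> Ide C (Go (fst X)))) \<cdot>\<^bsub>C\<^esub> (Ide C \<one>\<^bsub>C\<^esub> \<boxtimes>\<^bsub>C\<^esub> snd X)"
    by (subst phi_lunit) simp_all
  also have "\<dots> = Ga (lunit C (fst X)) \<cdot>\<^bsub>C\<^esub> \<phi> \<one>\<^bsub>C\<^esub> (fst X) \<cdot>\<^bsub>C\<^esub> (\<phi>0 \<boxtimes>\<^bsub>C\<^esub> snd X)"
    by simp
  finally show ?thesis
    using X by (simp add: EM_hom_iff EM_tensor_object EM_unit_object)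
qed

lemma EM_runit:
  assumes X: "X \<in> EM_objects"
  shows "runit C (fst X) \<in> EM_hom (X \<odot> EM_unit) X"
proof -
  note [simp] = EM_object_typing[OF X]
  have "snd X \<cdot>\<^bsub>C\<^esub> runit C (fst X)
      = runit C (Go (fst X)) \<cdot>\<^bsub>C\<^esub> (snd X \<boxtimes>\<^bsub>C\<^esub> Ide C \<one>\<^bsub>C\<^esub>)"
    by (simp add: source.runit_nat)
  also have "\<dots> = (Ga (runit C (fst X)) \<cdot>\<^bsub>C\<^esub> \<phi> (fst X) \<one>\<^bsub>C\<^esub>
      \<cdot>\<^bsub>C\<^esub> (Ide C (Go (fst X)) \<boxtimes>\<^bsub>C\<^esub> \<phi>0)) \<cdot>\<^bsub>C\<^esub> (snd X \<boxtimes>\<^bsub>C\<^esub> Ide C \<one>\<^bsub>C\<^esub>)"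
    by (subst phi_runit) simp_all
  also have "\<dots> = Ga (runit C (fst X)) \<cdot>\<^bsub>C\<^esub> \<phi> (fst X) \<one>\<^bsub>C\<^esub> \<cdot>\<^bsub>C\<^esub> (snd X \<boxtimes>\<^bsub>C\<^esub> \<phi>0)"
    by simp
  finally show ?thesis
    using X by (simp add: EM_hom_iff EM_tensor_object EM_unit_object)
qed

abbreviation EM :: "('o \<times> 'm, ('o, 'm) coalg_arr) moncat" where
  "EM \<equiv> coalgebra_category C Go Ga \<phi> \<phi>0 \<delta> \<epsilon>"

lemma EM_simps [simp]:
  "Obj EM = EM_objects"
  "Ide EM X = (X, Ide C (fst X), X)"
  "Comp EM (Y, g, Z) (X, f, Y') = (X, g \<cdot>\<^bsub>C\<^esub> f, Z)"
  "Dom EM (X, f, Y) = X"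
  "Cod EM (X, f, Y) = Y"
  "tensor_obj EM X Y = X \<odot> Y"
  "tensor_arr EM (X, f, Y) (X', g, Y') = (X \<odot> X', f \<boxtimes>\<^bsub>C\<^esub> g, Y \<odot> Y')"
  "unit_obj EM = EM_unit"
  "assoc EM X Y Z = ((X \<odot> Y) \<odot> Z, assoc C (fst X) (fst Y) (fst Z), X \<odot> Y \<odot> Z)"
  "lunit EM X = (EM_unit \<odot> X, lunit C (fst X), X)"
  "runit EM X = (X \<odot> EM_unit, runit C (fst X), X)"
  by (simp_all add: coalgebra_category_def Let_def)

lemma EM_Arr [simp]: "(X, f, Y) \<in> Arr EM \<longleftrightarrow> f \<in> EM_hom X Y"
  by (simp add: coalgebra_category_def EM_hom_def Let_def)

lemma hom_EM: "m \<in> hom EM X Y \<longleftrightarrow> (\<exists>f \<in> EM_hom X Y. m = (X, f, Y))"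
  by (cases m) (auto simp: hom_def)

lemma EM_iso:
  assumes f: "f \<in> EM_hom X Y" and "iso C f"
  shows "iso EM (X, f, Y)"
proof -
  have "inverse_arrows EM (X, f, Y) (Y, inverse_arr C f, X)"
    using f EM_inverse[OF assms] source.inverse_arrows_inverse_arr[OF assms(2)]
    by (simp add: inverse_arrows_def hom_EM EM_hom_iff)
  then show ?thesis
    unfolding iso_def by blast
qed

lemma EM_hom_hom: "f \<in> EM_hom X Y \<Longrightarrow> f \<in> hom C (fst X) (fst Y)"
  by (simp add: EM_hom_iff source.hom_iff)

lemma EM_hom_objects:
  assumes "f \<in> EM_hom X Y"
  shows "X \<in> EM_objects" and "Y \<in> EM_objects"
  using assms by (simp_all add: EM_hom_iff)

text \<open>
  The equational axioms are inherited from \<open>C\<close>, as composition and tensor product of coalgebra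
  morphisms are those of the underlying arrows. The remaining axioms say that the constraints and
  their inverses are coalgebra morphisms.
\<close>

lemma EM_monoidal_category: "monoidal_category EM"
proof
  fix m assume "m \<in> Arr EM"
  then show "Dom EM m \<in> Obj EM" and "Cod EM m \<in> Obj EM"
    by (cases m; simp add: EM_hom_iff)+
qed (auto simp: hom_EM EM_Ide EM_tensor_object EM_unit_object EM_assoc EM_lunit EM_runit EM_iso
    source.assoc_iso source.lunit_iso source.runit_iso source.pentagon source.triangle EM_hom_objects
    intro: EM_Comp EM_tensor_hom,
    simp_all add: EM_hom_iff source.assoc_nat source.lunit_nat source.runit_nat)

end

section \<open>Evaluation for a left raiser\<close>

context left_raising_functor
begin

lemma S_Obj [simp]: "A \<in> Obj C \<Longrightarrow> So A \<in> Obj C"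
  by (rule So_Obj)

lemma S_typing [simp]:
  assumes "f \<in> Arr C"
  shows "Sa f \<in> Arr C" and "Dom C (Sa f) = So (Cod C f)" and "Cod C (Sa f) = So (Dom C f)"
  using S.Fa_hom[of f "Cod C f" "Dom C f"] assms by (simp_all add: hom_iff)

lemma S_Ide [simp]: "A \<in> Obj C \<Longrightarrow> Sa (Ide C A) = Ide C (So A)"
  using S.Fa_Id[of A] by simp

lemma S_Comp [simp]:
  "f \<in> Arr C \<Longrightarrow> g \<in> Arr C \<Longrightarrow> Cod C f = Dom C g \<Longrightarrow> Sa (g \<cdot> f) = Sa f \<cdot> Sa g"
  using S.Fa_Comp[of g "Cod C g" "Cod C f" f "Dom C f"] by (simp add: hom_iff)

lemma D_in_Obj [simp]: "D \<in> Obj C"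
  by (rule D_Obj)

lemma varpi_hom: "f \<in> hom C A (So B) \<Longrightarrow> B \<in> Obj C \<Longrightarrow> varpi A B f \<in> hom C (A \<otimes> B) D"
  using varpi_bij[of A B] by (auto simp: bij_betw_def dest: hom_Objs)

lemma varpi_inj:
  assumes "f \<in> hom C A (So B)" and "g \<in> hom C A (So B)" and "B \<in> Obj C"
    and "varpi A B f = varpi A B g"
  shows "f = g"
  using varpi_bij[of A B] assms hom_Objs[OF assms(1)] by (auto simp: bij_betw_def dest: inj_onD)

text \<open>
  The universal arrow of the representation \<open>C(A, S B) \<cong> C(A \<otimes> B, D)\<close>. Every arrow into \<open>S B\<close>
  is characterised by its composite with it, and the arrows \<open>e\<close> and \<open>n\<^sub>I\<close> are used below only
  through these composites.
\<close>

definition ev :: "'o \<Rightarrow> 'm" where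
  "ev B = varpi (So B) B (Ide C (So B))"

lemma ev_typing [simp]:
  assumes "B \<in> Obj C"
  shows "ev B \<in> Arr C" and "Dom C (ev B) = So B \<otimes> B" and "Cod C (ev B) = D"
  using varpi_hom[of "Ide C (So B)" "So B" B] assms by (simp_all add: hom_iff ev_def)

lemma varpi_ev:
  assumes "f \<in> hom C A (So B)" and "B \<in> Obj C"
  shows "varpi A B f = ev B \<cdot> (f \<boxtimes> Ide C B)"
  using varpi_natural[of B f A "So B" "Ide C (So B)"] assms by (simp add: ev_def hom_iff)

lemma ev_inj:
  assumes "f \<in> hom C A (So B)" and "g \<in> hom C A (So B)" and "B \<in> Obj C"
    and "ev B \<cdot> (f \<boxtimes> Ide C B) = ev B \<cdot> (g \<boxtimes> Ide C B)"
  shows "f = g"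
  using assms by (intro varpi_inj[of f A B g]) (simp_all add: varpi_ev)

lemma ev_dinatural:
  assumes "h \<in> Arr C" and "Dom C h = A" and "Cod C h = B"
  shows "ev A \<cdot> (Sa h \<boxtimes> Ide C A) = ev B \<cdot> (Ide C (So B) \<boxtimes> h)"
proof -
  have "A \<in> Obj C" and "B \<in> Obj C"
    using assms Dom_Obj Cod_Obj by auto
  then show ?thesis
    using varpi_natural_right[of "So B" h A B "Ide C (So B)"] varpi_ev[of "Sa h" "So B" A] assms
    by (simp add: hom_iff ev_def)
qed

lemma ev_unit: "ev \<one> = runit C D"
  using varpi_unit[of D "Ide C D"] by (simp add: ev_def So_unit hom_iff)

lemma omega_ev:
  assumes f: "f \<in> hom C A (So (B \<otimes> E))" and B: "B \<in> Obj C" and E: "E \<in> Obj C"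
  defines "k \<equiv> raise_omega C So varpi A B E f"
  shows "k \<in> hom C (A \<otimes> B) (So E)"
    and "ev E \<cdot> (k \<boxtimes> Ide C E) = ev (B \<otimes> E) \<cdot> (f \<boxtimes> Ide C (B \<otimes> E)) \<cdot> assoc C A B E"
proof -
  have A: "A \<in> Obj C"
    using hom_Objs[OF f] by simp
  have "varpi A (B \<otimes> E) f \<cdot> assoc C A B E \<in> hom C ((A \<otimes> B) \<otimes> E) D"
    using varpi_hom[OF f] A B E by (simp add: hom_iff)
  then have im: "varpi A (B \<otimes> E) f \<cdot> assoc C A B E \<in> varpi (A \<otimes> B) E ` hom C (A \<otimes> B) (So E)"
    using varpi_bij[of "A \<otimes> B" E] A B E by (simp add: bij_betw_def)
  show k: "k \<in> hom C (A \<otimes> B) (So E)"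
    using inv_into_into[OF im] by (simp add: k_def raise_omega_def)
  have "varpi (A \<otimes> B) E k = varpi A (B \<otimes> E) f \<cdot> assoc C A B E"
    using f_inv_into_f[OF im] by (simp add: k_def raise_omega_def)
  then show "ev E \<cdot> (k \<boxtimes> Ide C E) = ev (B \<otimes> E) \<cdot> (f \<boxtimes> Ide C (B \<otimes> E)) \<cdot> assoc C A B E"
    using f k A B E by (simp add: varpi_ev) (simp add: hom_iff)
qed

text \<open>
  \<open>raise_rho\<close> is defined by choosing preimages under \<open>raise_omega\<close>; that choice is
  meaningful because precomposition with the associativity isomorphism is invertible.
\<close>

lemma omega_surj:
  assumes k: "k \<in> hom C (A \<otimes> B) (So E)" and A: "A \<in> Obj C" and B: "B \<in> Obj C" and E: "E \<in> Obj C"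
  shows "k \<in> raise_omega C So varpi A B E ` hom C A (So (B \<otimes> E))"
proof -
  note inv = inverse_arr_of_iso[OF assoc_iso[OF A B E] assoc_hom[OF A B E]]
  let ?g = "ev E \<cdot> (k \<boxtimes> Ide C E) \<cdot> inverse_arr C (assoc C A B E)"
  have "?g \<in> hom C (A \<otimes> (B \<otimes> E)) D"
    using k inv A B E by (simp add: hom_iff)
  then have "?g \<in> varpi A (B \<otimes> E) ` hom C A (So (B \<otimes> E))"
    using varpi_bij[of A "B \<otimes> E"] A B E by (simp add: bij_betw_def)
  then obtain f where fg: "?g = varpi A (B \<otimes> E) f" and f: "f \<in> hom C A (So (B \<otimes> E))"
    by (rule imageE)
  from fg[symmetric] f have "(ev (B \<otimes> E) \<cdot> (f \<boxtimes> Ide C (B \<otimes> E))) \<cdot> assoc C A B E = ?g \<cdot> assoc C A B E"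
    using B E by (simp add: varpi_ev)
  also have "\<dots> = ev E \<cdot> (k \<boxtimes> Ide C E)"
    using k inv A B E by (simp add: hom_iff)
  finally have "ev E \<cdot> (raise_omega C So varpi A B E f \<boxtimes> Ide C E) = ev E \<cdot> (k \<boxtimes> Ide C E)"
    using omega_ev[OF f B E] f A B E by (simp add: hom_iff)
  then have "raise_omega C So varpi A B E f = k"
    by (rule ev_inj[rotated 3]) (use omega_ev(1)[OF f B E] k E in simp_all)
  then show ?thesis
    using f by blast
qed

lemma rho_ev:
  assumes f: "f \<in> hom C A (So B)" and B: "B \<in> Obj C"
  defines "k \<equiv> raise_rho C So varpi A B f"
  shows "k \<in> hom C \<one> (So (A \<otimes> B))"
    and "ev (A \<otimes> B) \<cdot> (k \<boxtimes> Ide C (A \<otimes> B)) \<cdot> assoc C \<one> A B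
      = ev B \<cdot> ((f \<cdot> lunit C A) \<boxtimes> Ide C B)"
proof -
  have A: "A \<in> Obj C"
    using hom_Objs[OF f] by simp
  have "f \<cdot> lunit C A \<in> hom C (\<one> \<otimes> A) (So B)"
    using f A by (simp add: hom_iff)
  then have im: "f \<cdot> lunit C A \<in> raise_omega C So varpi \<one> A B ` hom C \<one> (So (A \<otimes> B))"
    using A B by (intro omega_surj) simp_all
  show k: "k \<in> hom C \<one> (So (A \<otimes> B))"
    using inv_into_into[OF im] by (simp add: k_def raise_rho_def)
  have "raise_omega C So varpi \<one> A B k = f \<cdot> lunit C A"
    using f_inv_into_f[OF im] by (simp add: k_def raise_rho_def)
  then show "ev (A \<otimes> B) \<cdot> (k \<boxtimes> Ide C (A \<otimes> B)) \<cdot> assoc C \<one> A B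
      = ev B \<cdot> ((f \<cdot> lunit C A) \<boxtimes> Ide C B)"
    using omega_ev(2)[OF k A B] by simp
qed

abbreviation e :: "'o \<Rightarrow> 'o \<Rightarrow> 'm" where
  "e \<equiv> raise_e C So varpi"

abbreviation nI :: 'm where
  "nI \<equiv> raise_n_unit C So Sa varpi"

lemma e_typing [simp]:
  assumes "B \<in> Obj C" and "E \<in> Obj C"
  shows "e B E \<in> Arr C" and "Dom C (e B E) = So (B \<otimes> E) \<otimes> B" and "Cod C (e B E) = So E"
  using omega_ev(1)[of "Ide C (So (B \<otimes> E))" "So (B \<otimes> E)" B E] assms
  by (simp_all add: raise_e_def hom_iff)

lemma e_ev:
  assumes "B \<in> Obj C" and "E \<in> Obj C"
  shows "ev E \<cdot> (e B E \<boxtimes> Ide C E) = ev (B \<otimes> E) \<cdot> assoc C (So (B \<otimes> E)) B E"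
  using omega_ev(2)[of "Ide C (So (B \<otimes> E))" "So (B \<otimes> E)" B E] assms
  by (simp add: raise_e_def hom_iff)

text \<open>
  Naturality of \<open>e\<close> in its target and dinaturality in its source, in one equation. Both sides
  have the same evaluation, since \<open>e\<close> evaluates to \<open>ev (B \<otimes> E)\<close> up to associativity.
\<close>

lemma e_dinatural:
  assumes k: "k \<in> hom C B' B" and h: "h \<in> hom C E' E"
  shows "Sa h \<cdot> e B E \<cdot> (Ide C (So (B \<otimes> E)) \<boxtimes> k) = e B' E' \<cdot> (Sa (k \<boxtimes> h) \<boxtimes> Ide C B')"
proof (rule ev_inj)
  note obj [simp] = hom_Objs[OF k] hom_Objs[OF h]
  note [simp] = k[unfolded hom_iff] h[unfolded hom_iff]
  let ?X = "So (B \<otimes> E)"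
  have "ev E' \<cdot> ((Sa h \<cdot> e B E \<cdot> (Ide C ?X \<boxtimes> k)) \<boxtimes> Ide C E')
      = (ev E' \<cdot> (Sa h \<boxtimes> Ide C E')) \<cdot> ((e B E \<cdot> (Ide C ?X \<boxtimes> k)) \<boxtimes> Ide C E')"
    by simp
  also have "\<dots> = (ev E \<cdot> (Ide C (So E) \<boxtimes> h)) \<cdot> ((e B E \<cdot> (Ide C ?X \<boxtimes> k)) \<boxtimes> Ide C E')"
    by (subst ev_dinatural[of h E' E]) simp_all
  also have "\<dots> = (ev E \<cdot> (e B E \<boxtimes> Ide C E)) \<cdot> ((Ide C ?X \<boxtimes> k) \<boxtimes> h)"
    by simp
  also have "\<dots> = ev (B \<otimes> E) \<cdot> assoc C ?X B E \<cdot> ((Ide C ?X \<boxtimes> k) \<boxtimes> h)"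
    by (subst e_ev) simp_all
  also have "\<dots> = (ev (B \<otimes> E) \<cdot> (Ide C ?X \<boxtimes> k \<boxtimes> h)) \<cdot> assoc C ?X B' E'"
    by (simp add: assoc_nat)
  also have "\<dots> = (ev (B' \<otimes> E') \<cdot> (Sa (k \<boxtimes> h) \<boxtimes> Ide C (B' \<otimes> E'))) \<cdot> assoc C ?X B' E'"
    by (subst ev_dinatural[of "k \<boxtimes> h" "B' \<otimes> E'" "B \<otimes> E"]) simp_all
  also have "\<dots> = ev (B' \<otimes> E') \<cdot> assoc C (So (B' \<otimes> E')) B' E'
      \<cdot> ((Sa (k \<boxtimes> h) \<boxtimes> Ide C B') \<boxtimes> Ide C E')"
    by (simp add: assoc_nat)
  also have "\<dots> = (ev E' \<cdot> (e B' E' \<boxtimes> Ide C E')) \<cdot> ((Sa (k \<boxtimes> h) \<boxtimes> Ide C B') \<boxtimes> Ide C E')"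
    by (subst e_ev) simp_all
  also have "\<dots> = ev E' \<cdot> ((e B' E' \<cdot> (Sa (k \<boxtimes> h) \<boxtimes> Ide C B')) \<boxtimes> Ide C E')"
    by simp
  finally show "ev E' \<cdot> ((Sa h \<cdot> e B E \<cdot> (Ide C ?X \<boxtimes> k)) \<boxtimes> Ide C E')
    = ev E' \<cdot> ((e B' E' \<cdot> (Sa (k \<boxtimes> h) \<boxtimes> Ide C B')) \<boxtimes> Ide C E')" .
qed (use k h hom_Objs[OF k] hom_Objs[OF h] in \<open>simp_all add: hom_iff\<close>)

text \<open>
  In the strict case \<open>n\<^sub>I : I \<rightarrow> S D\<close> names the identity of \<open>D\<close>. In general its definition
  through \<open>raise_rho\<close> and \<open>S (D \<otimes> I)\<close> contributes right unit and associativity constraints, and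
  \<open>runit_tensor_unit\<close> cancels them.
\<close>

lemma
  shows nI_hom: "nI \<in> hom C \<one> (So D)"
    and nI_ev: "ev D \<cdot> (nI \<boxtimes> Ide C D) = lunit C D"
proof -
  let ?n = "raise_n C So varpi \<one>" and ?r = "runit C D" and ?r' = "inverse_arr C (runit C D)"
  have n: "?n \<in> hom C \<one> (So (D \<otimes> \<one>))"
    and n_ev: "ev (D \<otimes> \<one>) \<cdot> (?n \<boxtimes> Ide C (D \<otimes> \<one>)) \<cdot> assoc C \<one> D \<one>
      = ev \<one> \<cdot> (lunit C D \<boxtimes> Ide C \<one>)"
    using rho_ev[of "Ide C D" D \<one>] by (simp_all add: raise_n_def So_unit hom_iff)
  note inv = inverse_arr_of_iso[OF runit_iso[OF D_Obj] runit_hom[OF D_Obj]]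
  note [simp] = n[unfolded hom_iff] inv[unfolded hom_iff]
  show "nI \<in> hom C \<one> (So D)"
    by (simp add: raise_n_unit_def So_unit hom_iff)
  have "(ev (D \<otimes> \<one>) \<cdot> (?n \<boxtimes> Ide C (D \<otimes> \<one>))) \<cdot> assoc C \<one> D \<one>
      = (lunit C D \<cdot> (Ide C \<one> \<boxtimes> ?r)) \<cdot> assoc C \<one> D \<one>"
    using n_ev runit_tensor_unit[of D] by (simp add: ev_unit runit_nat)
  then have key: "ev (D \<otimes> \<one>) \<cdot> (?n \<boxtimes> Ide C (D \<otimes> \<one>)) = lunit C D \<cdot> (Ide C \<one> \<boxtimes> ?r)"
    by (rule iso_cancel_right[rotated 6]) (simp_all add: assoc_iso)
  have "ev D \<cdot> ((Sa ?r' \<cdot> ?n) \<boxtimes> Ide C D) = (ev D \<cdot> (Sa ?r' \<boxtimes> Ide C D)) \<cdot> (?n \<boxtimes> Ide C D)"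
    by simp
  also have "\<dots> = (ev (D \<otimes> \<one>) \<cdot> (Ide C (So (D \<otimes> \<one>)) \<boxtimes> ?r')) \<cdot> (?n \<boxtimes> Ide C D)"
    by (subst ev_dinatural[of ?r' D "D \<otimes> \<one>"]) simp_all
  also have "\<dots> = (ev (D \<otimes> \<one>) \<cdot> (?n \<boxtimes> Ide C (D \<otimes> \<one>))) \<cdot> (Ide C \<one> \<boxtimes> ?r')"
    by simp
  also have "\<dots> = lunit C D"
    by (subst key) simp
  finally show "ev D \<cdot> (nI \<boxtimes> Ide C D) = lunit C D"
    by (simp add: raise_n_unit_def So_unit)
qed

text \<open>
  As \<open>S I = D\<close>, evaluation at \<open>B\<close> is \<open>e B \<one>\<close> up to constraints. Hence \<open>ev\<close> lifts
  to coalgebras as soon as \<open>e\<close> does.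
\<close>

lemma ev_e_unit:
  assumes B: "B \<in> Obj C"
  shows "ev B = e B \<one> \<cdot> runit C (So (B \<otimes> \<one>) \<otimes> B)
    \<cdot> inverse_arr C (assoc C (So (B \<otimes> \<one>)) B \<one>) \<cdot> (Sa (runit C B) \<boxtimes> inverse_arr C (runit C B))"
proof -
  let ?X = "So (B \<otimes> \<one>)" and ?r = "runit C B"
  have X: "?X \<in> Obj C"
    using B by simp
  note inv_a = inverse_arr_of_iso[OF assoc_iso assoc_hom, OF X B unit_Obj X B unit_Obj]
  note inv_r = inverse_arr_of_iso[OF runit_iso[OF B] runit_hom[OF B]]
  note [simp] = B inv_a[unfolded hom_iff] inv_r[unfolded hom_iff]
  have "ev B = (ev B \<cdot> (Ide C (So B) \<boxtimes> ?r)) \<cdot> (Ide C (So B) \<boxtimes> inverse_arr C ?r)"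
    by simp
  also have "\<dots> = (ev (B \<otimes> \<one>) \<cdot> (Sa ?r \<boxtimes> Ide C (B \<otimes> \<one>))) \<cdot> (Ide C (So B) \<boxtimes> inverse_arr C ?r)"
    by (subst ev_dinatural[of ?r "B \<otimes> \<one>" B]) simp_all
  also have "\<dots> = (ev (B \<otimes> \<one>) \<cdot> assoc C ?X B \<one>) \<cdot> inverse_arr C (assoc C ?X B \<one>)
      \<cdot> (Sa ?r \<boxtimes> inverse_arr C ?r)"
    by (simp add: Comp_extend[OF inv_a(3)])
  also have "\<dots> = (e B \<one> \<cdot> runit C (?X \<otimes> B)) \<cdot> inverse_arr C (assoc C ?X B \<one>)
      \<cdot> (Sa ?r \<boxtimes> inverse_arr C ?r)"
    using e_ev[of B \<one>] runit_nat[of "e B \<one>" D] by (simp add: ev_unit So_unit)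
  finally show ?thesis
    by simp
qed

text \<open>
  The inverse of \<open>varpi\<close> expressed by means of \<open>e\<close>, \<open>S\<close> and \<open>n\<^sub>I\<close>. Evaluating the composite at
  \<open>B\<close> turns \<open>e\<close> into evaluation at \<open>A \<otimes> B\<close>; dinaturality then moves \<open>g\<close> across the tensor,
  leaving the evaluation of \<open>n\<^sub>I\<close>, which is a unit constraint.
\<close>

lemma ev_transpose:
  assumes g: "g \<in> hom C (A \<otimes> B) D" and A: "A \<in> Obj C" and B: "B \<in> Obj C"
  shows "ev B \<cdot> ((e A B \<cdot> ((Sa g \<cdot> nI) \<boxtimes> Ide C A) \<cdot> inverse_arr C (lunit C A)) \<boxtimes> Ide C B) = g"
proof -
  let ?l' = "inverse_arr C (lunit C A)" and ?AB = "A \<otimes> B"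
  note inv = inverse_arr_of_iso[OF lunit_iso[OF A] lunit_hom[OF A]]
  note [simp] = A B g[unfolded hom_iff] inv[unfolded hom_iff] nI_hom[unfolded hom_iff]
  have "ev B \<cdot> ((e A B \<cdot> ((Sa g \<cdot> nI) \<boxtimes> Ide C A) \<cdot> ?l') \<boxtimes> Ide C B)
      = (ev B \<cdot> (e A B \<boxtimes> Ide C B)) \<cdot> (((Sa g \<cdot> nI) \<boxtimes> Ide C A) \<boxtimes> Ide C B) \<cdot> (?l' \<boxtimes> Ide C B)"
    by simp
  also have "\<dots> = ev ?AB \<cdot> (assoc C (So ?AB) A B \<cdot> (((Sa g \<cdot> nI) \<boxtimes> Ide C A) \<boxtimes> Ide C B))
      \<cdot> (?l' \<boxtimes> Ide C B)"
    by (subst e_ev) simp_all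
  also have "\<dots> = (ev ?AB \<cdot> (Sa g \<boxtimes> Ide C ?AB)) \<cdot> (nI \<boxtimes> Ide C ?AB) \<cdot> assoc C \<one> A B \<cdot> (?l' \<boxtimes> Ide C B)"
    by (simp add: assoc_nat)
  also have "\<dots> = (ev D \<cdot> (nI \<boxtimes> Ide C D)) \<cdot> (Ide C \<one> \<boxtimes> g) \<cdot> assoc C \<one> A B \<cdot> (?l' \<boxtimes> Ide C B)"
    by (subst ev_dinatural[of g ?AB D]) simp_all
  also have "\<dots> = (lunit C D \<cdot> (Ide C \<one> \<boxtimes> g)) \<cdot> assoc C \<one> A B \<cdot> (?l' \<boxtimes> Ide C B)"
    by (subst nI_ev) simp_all
  also have "\<dots> = g \<cdot> (lunit C ?AB \<cdot> assoc C \<one> A B) \<cdot> (?l' \<boxtimes> Ide C B)"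
    by (simp add: lunit_nat)
  also have "\<dots> = g"
    by (subst lunit_tensor) simp_all
  finally show ?thesis .
qed

end

section \<open>Lifting the left raiser to coalgebras\<close>

locale left_raising_comonad =
  left_raising_functor C D So Sa varpi +
  monoidal_comonad C Go Ga \<phi> \<phi>0 \<delta> \<epsilon> +
  nu: natural_transformation "op_cat C" C So Sa
    "\<lambda>A. Go (So (Go A))" "\<lambda>f. Ga (Sa (Ga f))" \<nu>
  for C :: "('o, 'm, 'x) moncat_scheme" (structure)
    and D So Sa varpi Go Ga \<phi> \<phi>0 \<delta> \<epsilon>
    and \<nu> :: "'o \<Rightarrow> 'm" +
  assumes nu_counit: "A \<in> Obj C \<Longrightarrow> \<epsilon> (So (Go A)) \<cdot> \<nu> A = Sa (\<epsilon> A)"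
    and nu_comult: "A \<in> Obj C \<Longrightarrow>
      \<delta> (So (Go A)) \<cdot> \<nu> A = Ga (Ga (Sa (\<delta> A))) \<cdot> Ga (\<nu> (Go A)) \<cdot> \<nu> A"
    and nu_e: "A \<in> Obj C \<Longrightarrow> B \<in> Obj C \<Longrightarrow>
      \<nu> B \<cdot> e A B \<cdot> (Ide C (So (A \<otimes> B)) \<boxtimes> \<epsilon> A)
        = Ga (e (Go A) (Go B)) \<cdot> Ga (Sa (\<phi> A B) \<boxtimes> Ide C (Go A))
            \<cdot> \<phi> (So (Go (A \<otimes> B))) (Go A) \<cdot> (\<nu> (A \<otimes> B) \<boxtimes> \<delta> A)"
    and nu_nI: "Ga nI \<cdot> \<phi>0
        = Ga (Sa (\<nu> \<one>)) \<cdot> Ga (Sa (Ga (Sa \<phi>0))) \<cdot> \<nu> (So \<one>) \<cdot> nI"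
begin

lemma nu_typing [simp]:
  assumes "A \<in> Obj C"
  shows "\<nu> A \<in> Arr C" and "Dom C (\<nu> A) = So A" and "Cod C (\<nu> A) = Go (So (Go A))"
  using nu.component_hom[of A] assms by (simp_all add: hom_iff)

lemma nu_nat:
  "f \<in> Arr C \<Longrightarrow> Dom C f = A \<Longrightarrow> \<nu> A \<cdot> Sa f = Ga (Sa (Ga f)) \<cdot> \<nu> (Cod C f)"
  using nu.naturality[of f "Cod C f" A] by (simp add: hom_iff)

definition EM_S :: "'o \<times> 'm \<Rightarrow> 'o \<times> 'm" where
  "EM_S X = (So (fst X), Ga (Sa (snd X)) \<cdot> \<nu> (fst X))"

lemma EM_S_sel [simp]:
  "fst (EM_S X) = So (fst X)" "snd (EM_S X) = Ga (Sa (snd X)) \<cdot> \<nu> (fst X)"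
  by (simp_all add: EM_S_def)

text \<open>
  The counit law reduces to \<open>S\<close> applied to the counit law of the given coalgebra, and the
  coassociativity law to \<open>S\<close> applied to its coassociativity law; naturality of \<open>\<nu>\<close> at the
  coaction closes the second calculation.
\<close>

lemma EM_S_object:
  assumes X: "X \<in> EM_objects"
  shows "EM_S X \<in> EM_objects"
proof -
  obtain B \<beta> where XB: "X = (B, \<beta>)"
    by (cases X)
  note [simp] = EM_object_typing[OF X, unfolded XB fst_conv snd_conv]
  note laws = EM_object_laws[OF X, unfolded XB fst_conv snd_conv]
  have "\<epsilon> (So B) \<cdot> Ga (Sa \<beta>) \<cdot> \<nu> B = (Sa \<beta> \<cdot> \<epsilon> (So (Go B))) \<cdot> \<nu> B"
    using epsilon_nat[of "Sa \<beta>" "So B"] by (intro Comp_extend) simp_all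
  also have "\<dots> = Sa (\<epsilon> B \<cdot> \<beta>)"
    by (simp add: nu_counit)
  also have "\<dots> = Ide C (So B)"
    by (simp add: laws del: S_Comp)
  finally have unit: "\<epsilon> (So B) \<cdot> Ga (Sa \<beta>) \<cdot> \<nu> B = Ide C (So B)" .
  have "\<delta> (So B) \<cdot> Ga (Sa \<beta>) \<cdot> \<nu> B = (Ga (Ga (Sa \<beta>)) \<cdot> \<delta> (So (Go B))) \<cdot> \<nu> B"
    using delta_nat[of "Sa \<beta>" "So B"] by (intro Comp_extend) simp_all
  also have "\<dots> = Ga (Ga (Sa (\<delta> B \<cdot> \<beta>))) \<cdot> Ga (\<nu> (Go B)) \<cdot> \<nu> B"
    by (simp add: nu_comult)
  also have "\<dots> = Ga (Ga (Sa \<beta>) \<cdot> (Ga (Sa (Ga \<beta>)) \<cdot> \<nu> (Go B))) \<cdot> \<nu> B"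
    by (subst laws) simp
  also have "\<dots> = Ga (Ga (Sa \<beta>) \<cdot> (\<nu> B \<cdot> Sa \<beta>)) \<cdot> \<nu> B"
    by (subst nu_nat) simp_all
  also have "\<dots> = Ga (Ga (Sa \<beta>) \<cdot> \<nu> B) \<cdot> Ga (Sa \<beta>) \<cdot> \<nu> B"
    by simp
  finally show ?thesis
    using unit by (simp add: XB EM_objects_iff del: EM_object_typing)
qed

lemma EM_S_hom:
  assumes g: "g \<in> EM_hom X Y"
  shows "Sa g \<in> EM_hom (EM_S Y) (EM_S X)"
proof -
  note [simp] = g[unfolded EM_hom_iff]
  have "(Ga (Sa (snd X)) \<cdot> \<nu> (fst X)) \<cdot> Sa g = Ga (Sa (snd X)) \<cdot> \<nu> (fst X) \<cdot> Sa g"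
    by simp
  also have "\<dots> = Ga (Sa (Ga g \<cdot> snd X)) \<cdot> \<nu> (fst Y)"
    by (simp add: nu_nat)
  also have "\<dots> = Ga (Sa (snd Y \<cdot> g)) \<cdot> \<nu> (fst Y)"
    by (simp del: S_Comp)
  also have "\<dots> = (Ga (Sa g) \<cdot> Ga (Sa (snd Y))) \<cdot> \<nu> (fst Y)"
    by (subst S_Comp) simp_all
  finally show ?thesis
    by (simp add: EM_hom_iff EM_S_object)
qed

text \<open>
  The factor \<open>1 \<boxtimes> \<epsilon> A\<close> in axiom \<open>nu_e\<close> is removed by precomposing with \<open>1 \<boxtimes> \<alpha>\<close>. This
  turns \<open>\<delta> A\<close> on the other side into \<open>G(\<alpha>) \<cdot> \<alpha>\<close>; the factor \<open>G(\<alpha>)\<close> passes through \<open>\<phi>\<close> and,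
  together with \<open>GS(\<beta>)\<close>, is absorbed by dinaturality of \<open>e\<close>, which produces the coaction
  of \<open>X \<odot> Y\<close>.
\<close>

lemma EM_e_hom:
  assumes X: "X \<in> EM_objects" and Y: "Y \<in> EM_objects"
  shows "e (fst X) (fst Y) \<in> EM_hom (EM_S (X \<odot> Y) \<odot> X) (EM_S Y)"
proof -
  obtain A \<alpha> B \<beta> where XY: "X = (A, \<alpha>)" "Y = (B, \<beta>)"
    by (cases X; cases Y)
  note [simp] = EM_object_typing[OF X, unfolded XY fst_conv snd_conv]
    EM_object_typing[OF Y, unfolded XY fst_conv snd_conv]
  note laws = EM_object_laws[OF X, unfolded XY fst_conv snd_conv]
  let ?S = "So (A \<otimes> B)" and ?SG = "So (Go (A \<otimes> B))" and ?N = "\<nu> (A \<otimes> B)"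
  have "Ga (Sa \<beta>) \<cdot> \<nu> B \<cdot> e A B
      = Ga (Sa \<beta>) \<cdot> (\<nu> B \<cdot> e A B \<cdot> (Ide C ?S \<boxtimes> \<epsilon> A)) \<cdot> (Ide C ?S \<boxtimes> \<alpha>)"
    by (simp add: laws)
  also have "\<dots> = Ga (Sa \<beta>) \<cdot> (Ga (e (Go A) (Go B)) \<cdot> Ga (Sa (\<phi> A B) \<boxtimes> Ide C (Go A))
      \<cdot> \<phi> ?SG (Go A) \<cdot> (?N \<boxtimes> \<delta> A)) \<cdot> (Ide C ?S \<boxtimes> \<alpha>)"
    by (subst nu_e) simp_all
  also have "\<dots> = Ga (Sa \<beta>) \<cdot> Ga (e (Go A) (Go B)) \<cdot> Ga (Sa (\<phi> A B) \<boxtimes> Ide C (Go A))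
      \<cdot> (\<phi> ?SG (Go A) \<cdot> (Ga (Ide C ?SG) \<boxtimes> Ga \<alpha>)) \<cdot> (?N \<boxtimes> \<alpha>)"
    by (simp add: laws)
  also have "\<dots> = Ga (Sa \<beta>) \<cdot> Ga (e (Go A) (Go B)) \<cdot> Ga (Sa (\<phi> A B) \<boxtimes> Ide C (Go A))
      \<cdot> (Ga (Ide C ?SG \<boxtimes> \<alpha>) \<cdot> \<phi> ?SG A) \<cdot> (?N \<boxtimes> \<alpha>)"
    by (subst phi_nat) simp_all
  also have "\<dots> = Ga (Sa \<beta> \<cdot> e (Go A) (Go B) \<cdot> (Sa (\<phi> A B) \<boxtimes> Ide C (Go A)) \<cdot> (Ide C ?SG \<boxtimes> \<alpha>))
      \<cdot> \<phi> ?SG A \<cdot> (?N \<boxtimes> \<alpha>)"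
    by (simp del: tensor_Comp tensor_Comp_extend)
  also have "Sa \<beta> \<cdot> e (Go A) (Go B) \<cdot> (Sa (\<phi> A B) \<boxtimes> Ide C (Go A)) \<cdot> (Ide C ?SG \<boxtimes> \<alpha>)
      = (Sa \<beta> \<cdot> e (Go A) (Go B) \<cdot> (Ide C (So (Go A \<otimes> Go B)) \<boxtimes> \<alpha>)) \<cdot> (Sa (\<phi> A B) \<boxtimes> Ide C A)"
    by simp
  also have "\<dots> = (e A B \<cdot> (Sa (\<alpha> \<boxtimes> \<beta>) \<boxtimes> Ide C A)) \<cdot> (Sa (\<phi> A B) \<boxtimes> Ide C A)"
    using e_dinatural[of \<alpha> A "Go A" \<beta> B "Go B"] by (simp add: hom_iff)
  also have "\<dots> = e A B \<cdot> (Sa (\<phi> A B \<cdot> (\<alpha> \<boxtimes> \<beta>)) \<boxtimes> Ide C A)"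
    by simp
  also have "Ga (e A B \<cdot> (Sa (\<phi> A B \<cdot> (\<alpha> \<boxtimes> \<beta>)) \<boxtimes> Ide C A)) \<cdot> \<phi> ?SG A \<cdot> (?N \<boxtimes> \<alpha>)
      = Ga (e A B) \<cdot> (Ga (Sa (\<phi> A B \<cdot> (\<alpha> \<boxtimes> \<beta>)) \<boxtimes> Ide C A) \<cdot> \<phi> ?SG A) \<cdot> (?N \<boxtimes> \<alpha>)"
    by simp
  also have "\<dots> = Ga (e A B) \<cdot> (\<phi> ?S A \<cdot> (Ga (Sa (\<phi> A B \<cdot> (\<alpha> \<boxtimes> \<beta>))) \<boxtimes> Ga (Ide C A))) \<cdot> (?N \<boxtimes> \<alpha>)"
    by (subst phi_nat) simp_all
  also have "\<dots> = Ga (e A B) \<cdot> \<phi> ?S A \<cdot> ((Ga (Sa (\<phi> A B \<cdot> (\<alpha> \<boxtimes> \<beta>))) \<cdot> ?N) \<boxtimes> \<alpha>)"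
    by simp
  finally have "Ga (Sa \<beta>) \<cdot> \<nu> B \<cdot> e A B
      = Ga (e A B) \<cdot> \<phi> ?S A \<cdot> ((Ga (Sa (\<phi> A B \<cdot> (\<alpha> \<boxtimes> \<beta>))) \<cdot> ?N) \<boxtimes> \<alpha>)" .
  then show ?thesis
    using X Y by (simp add: EM_hom_iff EM_tensor_object EM_S_object XY)
qed

abbreviation EM_D :: "'o \<times> 'm" where
  "EM_D \<equiv> (D, Ga (Sa \<phi>0) \<cdot> \<nu> \<one>)"

lemma EM_S_unit: "EM_S EM_unit = EM_D"
  by (simp add: EM_S_def So_unit)

lemma EM_D_object: "EM_D \<in> EM_objects"
  using EM_S_object[OF EM_unit_object] by (simp add: EM_S_unit)

lemma EM_nI_hom: "nI \<in> EM_hom EM_unit (EM_S EM_D)"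
proof -
  note [simp] = nI_hom[unfolded hom_iff]
  have "(Ga (Sa (Ga (Sa \<phi>0) \<cdot> \<nu> \<one>)) \<cdot> \<nu> D) \<cdot> nI = Ga nI \<cdot> \<phi>0"
    using nu_nI by (simp add: So_unit)
  then show ?thesis
    by (simp add: EM_hom_iff EM_unit_object EM_S_object EM_D_object)
qed

lemma EM_ev_hom:
  assumes Y: "Y \<in> EM_objects"
  shows "ev (fst Y) \<in> EM_hom (EM_S Y \<odot> Y) EM_D"
proof -
  let ?Z = "EM_S (Y \<odot> EM_unit)"
  have Z: "?Z \<in> EM_objects"
    using Y by (simp add: EM_S_object EM_tensor_object EM_unit_object)
  have "inverse_arr C (assoc C (fst ?Z) (fst Y) \<one>) \<in> EM_hom (?Z \<odot> Y \<odot> EM_unit) ((?Z \<odot> Y) \<odot> EM_unit)"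
    using EM_inverse[OF EM_assoc[OF Z Y EM_unit_object]] Z Y by (simp add: assoc_iso)
  moreover have "inverse_arr C (runit C (fst Y)) \<in> EM_hom Y (Y \<odot> EM_unit)"
    using EM_inverse[OF EM_runit[OF Y]] Y by (simp add: runit_iso)
  moreover have "Sa (runit C (fst Y)) \<in> EM_hom (EM_S Y) ?Z"
    using EM_runit[OF Y] by (rule EM_S_hom)
  moreover have "e (fst Y) \<one> \<in> EM_hom (?Z \<odot> Y) EM_D"
    using EM_e_hom[OF Y EM_unit_object] by (simp add: EM_S_unit)
  moreover have "runit C (fst ?Z \<otimes> fst Y) \<in> EM_hom ((?Z \<odot> Y) \<odot> EM_unit) (?Z \<odot> Y)"
    using EM_runit[OF EM_tensor_object[OF Z Y]] by simp
  ultimately have "e (fst Y) \<one> \<cdot> runit C (fst ?Z \<otimes> fst Y)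
      \<cdot> inverse_arr C (assoc C (fst ?Z) (fst Y) \<one>)
      \<cdot> (Sa (runit C (fst Y)) \<boxtimes> inverse_arr C (runit C (fst Y))) \<in> EM_hom (EM_S Y \<odot> Y) EM_D"
    by (meson EM_Comp EM_tensor_hom)
  then show ?thesis
    using Y by (simp add: ev_e_unit)
qed

text \<open>
  Both \<open>varpi f\<close> and, conversely, \<open>f\<close> are composites of coalgebra morphisms: the first by
  evaluation, the second by \<open>ev_transpose\<close> and injectivity of \<open>varpi\<close>.
\<close>

lemma EM_varpi_iff:
  assumes X: "X \<in> EM_objects" and Y: "Y \<in> EM_objects" and f: "f \<in> hom C (fst X) (So (fst Y))"
  shows "varpi (fst X) (fst Y) f \<in> EM_hom (X \<odot> Y) EM_D \<longleftrightarrow> f \<in> EM_hom X (EM_S Y)"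
proof
  let ?A = "fst X" and ?B = "fst Y"
  have obj: "?A \<in> Obj C" "?B \<in> Obj C"
    using X Y by simp_all
  have varpi: "varpi ?A ?B f = ev ?B \<cdot> (f \<boxtimes> Ide C ?B)"
    using f obj by (simp add: varpi_ev)
  show "varpi ?A ?B f \<in> EM_hom (X \<odot> Y) EM_D" if "f \<in> EM_hom X (EM_S Y)"
    unfolding varpi by (rule EM_Comp[OF EM_tensor_hom[OF that EM_Ide[OF Y]] EM_ev_hom[OF Y]])
  assume g: "varpi ?A ?B f \<in> EM_hom (X \<odot> Y) EM_D"
  let ?l' = "inverse_arr C (lunit C ?A)"
  let ?f = "e ?A ?B \<cdot> ((Sa (varpi ?A ?B f) \<cdot> nI) \<boxtimes> Ide C ?A) \<cdot> ?l'"
  have "?l' \<in> EM_hom X (EM_unit \<odot> X)"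
    using EM_inverse[OF EM_lunit[OF X]] obj by (simp add: lunit_iso)
  then have f': "?f \<in> EM_hom X (EM_S Y)"
    by (meson EM_Comp EM_tensor_hom EM_Ide X EM_e_hom[OF X Y] EM_S_hom[OF g] EM_nI_hom)
  have "ev ?B \<cdot> (?f \<boxtimes> Ide C ?B) = ev ?B \<cdot> (f \<boxtimes> Ide C ?B)"
    using ev_transpose[OF varpi_hom[OF f] obj] obj varpi by simp
  then have "?f = f"
    by (rule ev_inj[rotated 3]) (use EM_hom_hom[OF f'] f obj in simp_all)
  then show "f \<in> EM_hom X (EM_S Y)"
    using f' by simp
qed

definition EM_varpi :: "'o \<times> 'm \<Rightarrow> 'o \<times> 'm \<Rightarrow> ('o, 'm) coalg_arr \<Rightarrow> ('o, 'm) coalg_arr" where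
  "EM_varpi X Y = (\<lambda>(_, f, _). (X \<odot> Y, varpi (fst X) (fst Y) f, EM_D))"

lemma EM_varpi_bij:
  assumes X: "X \<in> EM_objects" and Y: "Y \<in> EM_objects"
  shows "bij_betw (EM_varpi X Y) (hom EM X (EM_S Y)) (hom EM (X \<odot> Y) EM_D)"
proof (rule bij_betw_imageI)
  have obj: "fst X \<in> Obj C" "fst Y \<in> Obj C"
    using X Y by simp_all
  show "inj_on (EM_varpi X Y) (hom EM X (EM_S Y))"
  proof (rule inj_onI)
    fix m m'
    assume "m \<in> hom EM X (EM_S Y)" and "m' \<in> hom EM X (EM_S Y)"
      and eq: "EM_varpi X Y m = EM_varpi X Y m'"
    then obtain f f' where "f \<in> EM_hom X (EM_S Y)" and "f' \<in> EM_hom X (EM_S Y)"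
      and m: "m = (X, f, EM_S Y)" "m' = (X, f', EM_S Y)"
      by (auto simp: hom_EM)
    then have "f = f'"
      using eq obj by (intro varpi_inj[of f "fst X" "fst Y" f']) (auto simp: EM_varpi_def dest: EM_hom_hom)
    then show "m = m'"
      by (simp add: m)
  qed
  show "EM_varpi X Y ` hom EM X (EM_S Y) = hom EM (X \<odot> Y) EM_D"
  proof
    show "EM_varpi X Y ` hom EM X (EM_S Y) \<subseteq> hom EM (X \<odot> Y) EM_D"
    proof
      fix m assume "m \<in> EM_varpi X Y ` hom EM X (EM_S Y)"
      then obtain f where f: "f \<in> EM_hom X (EM_S Y)" and m: "m = EM_varpi X Y (X, f, EM_S Y)"
        by (auto simp: hom_EM)
      show "m \<in> hom EM (X \<odot> Y) EM_D"
        using f EM_varpi_iff[OF X Y, of f] EM_hom_hom[OF f] by (simp add: m hom_EM EM_varpi_def)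
    qed
    show "hom EM (X \<odot> Y) EM_D \<subseteq> EM_varpi X Y ` hom EM X (EM_S Y)"
    proof
      fix m assume "m \<in> hom EM (X \<odot> Y) EM_D"
      then obtain g where g: "g \<in> EM_hom (X \<odot> Y) EM_D" and m: "m = (X \<odot> Y, g, EM_D)"
        by (auto simp: hom_EM)
      have "g \<in> varpi (fst X) (fst Y) ` hom C (fst X) (So (fst Y))"
        using varpi_bij[of "fst X" "fst Y"] EM_hom_hom[OF g] obj by (simp add: bij_betw_def)
      then obtain f where f: "f \<in> hom C (fst X) (So (fst Y))" and fg: "g = varpi (fst X) (fst Y) f"
        by auto
      have "f \<in> EM_hom X (EM_S Y)"
        using g EM_varpi_iff[OF X Y f] by (simp add: fg)
      moreover have "m = EM_varpi X Y (X, f, EM_S Y)"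
        by (simp add: m fg EM_varpi_def)
      ultimately show "m \<in> EM_varpi X Y ` hom EM X (EM_S Y)"
        by (auto simp: hom_EM)
    qed
  qed
qed

lemma EM_left_raising: "left_raising EM EM_D EM_S EM_varpi"
proof (intro left_raising.intro left_raising_axioms.intro EM_monoidal_category)
  fix Y m X' X n
  assume Y: "Y \<in> Obj EM" and "m \<in> hom EM X' X" and "n \<in> hom EM X (EM_S Y)"
  then obtain f g where f: "f \<in> EM_hom X' X" and m: "m = (X', f, X)"
    and g: "g \<in> EM_hom X (EM_S Y)" and n: "n = (X, g, EM_S Y)"
    by (auto simp: hom_EM)
  have "varpi (fst X') (fst Y) (g \<cdot> f) = varpi (fst X) (fst Y) g \<cdot> (f \<boxtimes> Ide C (fst Y))"
    using varpi_natural[of "fst Y" f "fst X'" "fst X" g] EM_hom_hom[OF f] EM_hom_hom[OF g] Y by simp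
  then show "EM_varpi X' Y (Comp EM n m) = Comp EM (EM_varpi X Y n) (tensor_arr EM m (Ide EM Y))"
    by (simp add: m n EM_varpi_def)
next
  fix X n
  assume X: "X \<in> Obj EM" and "n \<in> hom EM X EM_D"
  then obtain g where g: "g \<in> EM_hom X EM_D" and n: "n = (X, g, EM_D)"
    by (auto simp: hom_EM)
  then show "EM_varpi X (unit_obj EM) n = Comp EM n (runit EM X)"
    using varpi_unit[of "fst X" g] EM_hom_hom[OF g] X by (simp add: EM_varpi_def)
qed (simp_all add: EM_D_object EM_S_object EM_varpi_bij EM_S_unit)

end

theorem theorem2p5:
  fixes C :: "('o, 'm, 'x) moncat_scheme" (structure)
    and D :: 'o
    and So :: "'o \<Rightarrow> 'o" and Sa :: "'m \<Rightarrow> 'm"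
    and varpi :: "'o \<Rightarrow> 'o \<Rightarrow> 'm \<Rightarrow> 'm"
    and Go :: "'o \<Rightarrow> 'o" and Ga :: "'m \<Rightarrow> 'm"
    and \<phi> :: "'o \<Rightarrow> 'o \<Rightarrow> 'm" and \<phi>0 :: 'm
    and \<delta> \<epsilon> \<nu> :: "'o \<Rightarrow> 'm"
  defines "e \<equiv> raise_e C So varpi"
    and "nI \<equiv> raise_n_unit C So Sa varpi"
  assumes raiser: "left_raising_functor C D So Sa varpi"
    and comonad: "monoidal_comonad C Go Ga \<phi> \<phi>0 \<delta> \<epsilon>"
    and nu: "natural_transformation (op_cat C) C So Sa
      (\<lambda>A. Go (So (Go A))) (\<lambda>f. Ga (Sa (Ga f))) \<nu>"
    and axiom1: "\<And>A. A \<in> Obj C \<Longrightarrow> \<epsilon> (So (Go A)) \<cdot> \<nu> A = Sa (\<epsilon> A)"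
    and axiom2: "\<And>A. A \<in> Obj C \<Longrightarrow>
      \<delta> (So (Go A)) \<cdot> \<nu> A = Ga (Ga (Sa (\<delta> A))) \<cdot> Ga (\<nu> (Go A)) \<cdot> \<nu> A"
    and axiom3: "\<And>A B. A \<in> Obj C \<Longrightarrow> B \<in> Obj C \<Longrightarrow>
      \<nu> B \<cdot> e A B \<cdot> (Ide C (So (A \<otimes> B)) \<boxtimes> \<epsilon> A)
        = Ga (e (Go A) (Go B)) \<cdot> Ga (Sa (\<phi> A B) \<boxtimes> Ide C (Go A))
            \<cdot> \<phi> (So (Go (A \<otimes> B))) (Go A) \<cdot> (\<nu> (A \<otimes> B) \<boxtimes> \<delta> A)"
    and axiom4: "Ga nI \<cdot> \<phi>0
        = Ga (Sa (\<nu> \<one>)) \<cdot> Ga (Sa (Ga (Sa \<phi>0))) \<cdot> \<nu> (So \<one>) \<cdot> nI"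
  shows "left_raiser (coalgebra_category C Go Ga \<phi> \<phi>0 \<delta> \<epsilon>) (D, Ga (Sa \<phi>0) \<cdot> \<nu> \<one>)"
proof -
  interpret left_raising_comonad C D So Sa varpi Go Ga \<phi> \<phi>0 \<delta> \<epsilon> \<nu>
    using raiser comonad nu axiom1 axiom2 axiom3 axiom4
    unfolding e_def nI_def
    by (intro left_raising_comonad.intro left_raising_comonad_axioms.intro)
  show ?thesis
    using EM_left_raising by (auto simp: left_raiser_def)
qed

end
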